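(* Consider a tabular contextual bandit and a rating model $h$ of degree $q$ as described in the context, and a sampling distribution $d$ for which there exists an optimal policy $\pi^\star$ such that $d(s,a)>0$ whenever $d_\rho^{\pi^\star}(s,a)>0$, for any $(s,a)\in\mathcal S\times\mathcal A$. Let $\mathcal X=\{(s,a)\in\mathcal S\times\mathcal A: d(s,a)>0\}$ and $\bar d=\min_{(s,a)\in\mathcal X}d(s,a)$. For any fixed constant $0<\delta<1$, if one runs the LCB algorithm on a human-rating dataset of size $n$ sampled using $d$, with penalty $$b_m=c_b\sqrt{\frac{V_{R,\sigma}^2\log^q\frac{SA}{\delta}}{m}}$$ and an appropriately chosen universal constant $c_b$, then as soon as $n>8\log\frac{2SA}{\delta}/\bar d$, with probability $1-\delta$ the output policy $\widehat\pi_{\rm LCB}$ satisfies $$\mathrm{SubOpt}(\widehat\pi_{\rm LCB})\le c_0\sum_{(s,a)\in\mathcal X}d_\rho^{\pi^\star}(s,a)\cdot\bar h^{-1}\!\left(\sqrt{\frac{V_{R,\sigma}^2\log^q\frac{SA}{\delta}}{n\cdot d(s,a)}}\right),$$ where $c_0$ is a constant that depends on $q$.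
   Context: Contextual bandit: $(\mathcal S,\mathcal A,r,\rho)$ with $\mathcal S=\{1,\dots,S\}$, $\mathcal A=\{1,\dots,A\}$, unknown deterministic reward $r:\mathcal S\times\mathcal A\to[0,R]$, and initial state distribution $\rho$. A policy is $\pi:\mathcal S\to\Delta(\mathcal A)$; $d^\pi_\rho(s,a)=\rho(s)\pi(a|s)$ is its state-action visitation distribution; $\pi^\star$ denotes an optimal policy (maximizing $\mathbb E_{a\sim\pi(\cdot|s)}[r(s,a)]$ for all $s$). $\mathrm{SubOpt}(\pi)=\mathbb E_{s\sim\rho}\big[\mathbb E_{a\sim\pi^\star(\cdot|s)}r(s,a)-\mathbb E_{a\sim\pi(\cdot|s)}r(s,a)\big]$. Rating model: a human rating of $(s,a)$ is $h(r(s,a),\epsilon)$, where $h$ is a deterministic function and $\epsilon\sim\mathcal N(0,\sigma^2)$ is independent of $(s,a)$. Put $\bar h(r)=\mathbb E_\epsilon[h(r,\epsilon)]$. It is assumed that: 1. $\bar h$ maps $[0,R]$ into $[0,R]$, is strictly increasing, and $\bar h(0)=0$. 2. For every $r\in[0,R]$, $h(r,\epsilon)$ is a degree-$q$ polynomial in $\epsilon$, and $-(h(r,\epsilon)-\mathbb E[h(r,\epsilon)])$ has the same distribution as $h(r,\epsilon)-\mathbb E[h(r,\epsilon)]$. 3. There are positive constants $C_{h,1},C_{h,2}$ such that for all $r_1\ge r_2$ in $[0,R]$: $\bar h^{-1}(r_1)-\bar h^{-1}(r_2)\le C_{h,1}\bar h^{-1}(r_1-r_2)$ and $\bar h(r_1)-\bar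 h(r_2)\le C_{h,2}\bar h(r_1-r_2)$. $V_{R,\sigma}^2$ is an upper bound on $\mathrm{Var}_\epsilon(h(r,\epsilon))$ over $r\in[0,R]$. Dataset: $\mathcal D=\{(s_i,a_i,\widetilde r_i)\}_{i=1}^n$ with $(s_i,a_i)$ i.i.d. from $d$ and $\widetilde r_i=h(r(s_i,a_i),\epsilon_i)$, with $\epsilon_i$ i.i.d. $\mathcal N(0,\sigma^2)$. LCB algorithm (input $\mathcal D$, $\delta$): for each $(s,a)$ let $n_{(s,a)}$ be the number of $i$ with $(s_i,a_i)=(s,a)$, let $\widetilde r(s,a)=\frac1{n_{(s,a)}}\sum_{i}\widetilde r_i\mathbf 1\{(s_i,a_i)=(s,a)\}$, and $\widehat r(s,a)=\max\{\widetilde r(s,a)-b_{n_{(s,a)}},0\}$ (with $\widehat r(s,a)=0$ if $n_{(s,a)}=0$). Output $\widehat\pi_{\rm LCB}(s)=\arg\max_{a}\widehat r(s,a)$. Here $\log^q x=(\log x)^q$.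
   Formalization: The constant c_0 may depend on the rating-model constants C_{h,1}, C_{h,2} as well as on q; with dependence on q alone the bound fails, e.g. for q=1 and a mean rating of slope 1 on [0,1/2] and slope η→0 on [1/2,1]. *)

theory Defs
  imports "HOL-Probability.Probability" "HOL-Computational_Algebra.Polynomial"
begin

text \<open>
  States are \<open>{1..S}\<close>, actions are \<open>{1..A}\<close>. Keeping them as subsets of \<open>nat\<close> rather than as
  types lets constants be quantified outside of \<open>S\<close> and \<open>A\<close>. Values of the functions below
  outside these carriers are irrelevant.
\<close>

definition contextual_bandit ::
    "nat \<Rightarrow> nat \<Rightarrow> real \<Rightarrow> (nat \<Rightarrow> nat \<Rightarrow> real) \<Rightarrow> nat pmf \<Rightarrow> bool" where
  "contextual_bandit S A R r \<rho> \<longleftrightarrow>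
     1 \<le> S \<and> 1 \<le> A \<and> (\<forall>s\<in>{1..S}. \<forall>a\<in>{1..A}. r s a \<in> {0..R}) \<and> set_pmf \<rho> \<subseteq> {1..S}"

definition is_policy :: "nat \<Rightarrow> nat \<Rightarrow> (nat \<Rightarrow> nat pmf) \<Rightarrow> bool" where
  "is_policy S A \<pi> \<longleftrightarrow> (\<forall>s\<in>{1..S}. set_pmf (\<pi> s) \<subseteq> {1..A})"

definition expected_reward :: "(nat \<Rightarrow> nat \<Rightarrow> real) \<Rightarrow> (nat \<Rightarrow> nat pmf) \<Rightarrow> nat \<Rightarrow> real" where
  "expected_reward r \<pi> s = measure_pmf.expectation (\<pi> s) (r s)"

definition is_optimal_policy ::
    "nat \<Rightarrow> nat \<Rightarrow> (nat \<Rightarrow> nat \<Rightarrow> real) \<Rightarrow> (nat \<Rightarrow> nat pmf) \<Rightarrow> bool" where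
  "is_optimal_policy S A r \<pi>opt \<longleftrightarrow> is_policy S A \<pi>opt \<and>
     (\<forall>\<pi>. is_policy S A \<pi> \<longrightarrow> (\<forall>s\<in>{1..S}. expected_reward r \<pi> s \<le> expected_reward r \<pi>opt s))"

definition visitation :: "nat pmf \<Rightarrow> (nat \<Rightarrow> nat pmf) \<Rightarrow> nat \<Rightarrow> nat \<Rightarrow> real" where
  "visitation \<rho> \<pi> s a = pmf \<rho> s * pmf (\<pi> s) a"

definition SubOpt ::
    "(nat \<Rightarrow> nat \<Rightarrow> real) \<Rightarrow> nat pmf \<Rightarrow> (nat \<Rightarrow> nat pmf) \<Rightarrow> (nat \<Rightarrow> nat pmf) \<Rightarrow> real" where
  "SubOpt r \<rho> \<pi>opt \<pi> =
     measure_pmf.expectation \<rho> (\<lambda>s. expected_reward r \<pi>opt s - expected_reward r \<pi> s)"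

definition noise :: "real \<Rightarrow> real measure" where
  "noise \<sigma> = density lborel (normal_density 0 \<sigma>)"

definition mean_rating :: "(real \<Rightarrow> real \<Rightarrow> real) \<Rightarrow> real \<Rightarrow> real \<Rightarrow> real" where
  "mean_rating h \<sigma> x = (\<integral>\<epsilon>. h x \<epsilon> \<partial>noise \<sigma>)"

definition rating_variance :: "(real \<Rightarrow> real \<Rightarrow> real) \<Rightarrow> real \<Rightarrow> real \<Rightarrow> real" where
  "rating_variance h \<sigma> x = (\<integral>\<epsilon>. (h x \<epsilon> - mean_rating h \<sigma> x)\<^sup>2 \<partial>noise \<sigma>)"

text \<open>
  The mean rating is injective on \<open>[0,R]\<close> but need not be onto \<open>[0,R]\<close>, and its inverse is
  also evaluated at arguments larger than \<open>R\<close>. The generalized inverse below is the true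
  inverse on the image of \<open>[0,R]\<close> and saturates at \<open>R\<close> above the image; see the two lemmas
  that follow.
\<close>

definition mean_rating_inv :: "real \<Rightarrow> (real \<Rightarrow> real \<Rightarrow> real) \<Rightarrow> real \<Rightarrow> real \<Rightarrow> real" where
  "mean_rating_inv R h \<sigma> y = Sup {x \<in> {0..R}. mean_rating h \<sigma> x \<le> y}"

lemma mean_rating_inv_mean_rating:
  assumes "strict_mono_on {0..R} (mean_rating h \<sigma>)" and "x \<in> {0..R}"
  shows "mean_rating_inv R h \<sigma> (mean_rating h \<sigma> x) = x"
proof -
  have "{x' \<in> {0..R}. mean_rating h \<sigma> x' \<le> mean_rating h \<sigma> x} = {0..x}"
    using assms by (auto simp: strict_mono_on_less_eq)
  then show ?thesis
    using assms(2) by (simp add: mean_rating_inv_def)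
qed

lemma mean_rating_inv_saturated:
  assumes "strict_mono_on {0..R} (mean_rating h \<sigma>)" and "0 \<le> R" and "mean_rating h \<sigma> R \<le> y"
  shows "mean_rating_inv R h \<sigma> y = R"
proof -
  have "mean_rating h \<sigma> x \<le> y" if "x \<in> {0..R}" for x
  proof -
    have "mean_rating h \<sigma> x \<le> mean_rating h \<sigma> R"
      using that assms(1,2) by (subst strict_mono_on_less_eq[OF assms(1)]) auto
    then show ?thesis using assms(3) by simp
  qed
  then have "{x \<in> {0..R}. mean_rating h \<sigma> x \<le> y} = {0..R}" by auto
  then show ?thesis
    using assms(2) by (simp add: mean_rating_inv_def)
qed

definition rating_model ::
    "nat \<Rightarrow> real \<Rightarrow> real \<Rightarrow> (real \<Rightarrow> real \<Rightarrow> real) \<Rightarrow> real \<Rightarrow> real \<Rightarrow> bool" where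
  "rating_model q R \<sigma> h C1 C2 \<longleftrightarrow>
     0 < \<sigma> \<and> 0 < C1 \<and> 0 < C2 \<and>
     mean_rating h \<sigma> ` {0..R} \<subseteq> {0..R} \<and>
     strict_mono_on {0..R} (mean_rating h \<sigma>) \<and>
     mean_rating h \<sigma> 0 = 0 \<and>
     (\<forall>x\<in>{0..R}. \<exists>p :: real poly. degree p = q \<and> (\<forall>\<epsilon>. h x \<epsilon> = poly p \<epsilon>)) \<and>
     (\<forall>x\<in>{0..R}.
        distr (noise \<sigma>) borel (\<lambda>\<epsilon>. - (h x \<epsilon> - mean_rating h \<sigma> x)) =
        distr (noise \<sigma>) borel (\<lambda>\<epsilon>. h x \<epsilon> - mean_rating h \<sigma> x)) \<and>
     (\<forall>x\<in>{0..R}. \<forall>y\<in>{0..R}. y \<le> x \<longrightarrow>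
        mean_rating_inv R h \<sigma> x - mean_rating_inv R h \<sigma> y \<le> C1 * mean_rating_inv R h \<sigma> (x - y)) \<and>
     (\<forall>x\<in>{0..R}. \<forall>y\<in>{0..R}. y \<le> x \<longrightarrow>
        mean_rating h \<sigma> x - mean_rating h \<sigma> y \<le> C2 * mean_rating h \<sigma> (x - y))"

text \<open>
  An outcome assigns to each index \<open>i < n\<close> a pair \<open>((s\<^sub>i, a\<^sub>i), \<epsilon>\<^sub>i)\<close>; all
  components are independent. The dataset seen by the algorithm consists of the pairs
  \<open>((s\<^sub>i, a\<^sub>i), h (r s\<^sub>i a\<^sub>i) \<epsilon>\<^sub>i)\<close>.
\<close>

definition sampling_space ::
    "nat \<Rightarrow> (nat \<times> nat) pmf \<Rightarrow> real \<Rightarrow> (nat \<Rightarrow> (nat \<times> nat) \<times> real) measure" where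
  "sampling_space n d \<sigma> = (\<Pi>\<^sub>M i\<in>{..<n}. measure_pmf d \<Otimes>\<^sub>M noise \<sigma>)"

definition dataset ::
    "(real \<Rightarrow> real \<Rightarrow> real) \<Rightarrow> (nat \<Rightarrow> nat \<Rightarrow> real) \<Rightarrow> (nat \<Rightarrow> (nat \<times> nat) \<times> real) \<Rightarrow>
     nat \<Rightarrow> (nat \<times> nat) \<times> real" where
  "dataset h r \<omega> i = (case \<omega> i of ((s, a), \<epsilon>) \<Rightarrow> ((s, a), h (r s a) \<epsilon>))"

definition sampled_pairs :: "nat \<Rightarrow> nat \<Rightarrow> (nat \<times> nat) pmf \<Rightarrow> (nat \<times> nat) set" where
  "sampled_pairs S A d = {(s, a) \<in> {1..S} \<times> {1..A}. pmf d (s, a) > 0}"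

definition min_sampling_prob :: "nat \<Rightarrow> nat \<Rightarrow> (nat \<times> nat) pmf \<Rightarrow> real" where
  "min_sampling_prob S A d = Min (pmf d ` sampled_pairs S A d)"

definition visit_count :: "nat \<Rightarrow> (nat \<Rightarrow> (nat \<times> nat) \<times> real) \<Rightarrow> nat \<Rightarrow> nat \<Rightarrow> nat" where
  "visit_count n D s a = card {i. i < n \<and> fst (D i) = (s, a)}"

definition average_rating :: "nat \<Rightarrow> (nat \<Rightarrow> (nat \<times> nat) \<times> real) \<Rightarrow> nat \<Rightarrow> nat \<Rightarrow> real" where
  "average_rating n D s a =
     (\<Sum>i | i < n \<and> fst (D i) = (s, a). snd (D i)) / real (visit_count n D s a)"

definition lcb_reward ::
    "(nat \<Rightarrow> real) \<Rightarrow> nat \<Rightarrow> (nat \<Rightarrow> (nat \<times> nat) \<times> real) \<Rightarrow> nat \<Rightarrow> nat \<Rightarrow> real" where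
  "lcb_reward b n D s a =
     (if visit_count n D s a = 0 then 0
      else max (average_rating n D s a - b (visit_count n D s a)) 0)"

text \<open>
  The algorithm does not fix how ties in the arg max are broken, hence a predicate
  characterizing all its possible outputs.
\<close>

definition lcb_output ::
    "nat \<Rightarrow> nat \<Rightarrow> (nat \<Rightarrow> real) \<Rightarrow> nat \<Rightarrow> (nat \<Rightarrow> (nat \<times> nat) \<times> real) \<Rightarrow> (nat \<Rightarrow> nat) \<Rightarrow> bool" where
  "lcb_output S A b n D f \<longleftrightarrow>
     (\<forall>s\<in>{1..S}. is_arg_max (lcb_reward b n D s) (\<lambda>a. a \<in> {1..A}) (f s))"

abbreviation deterministic_policy :: "(nat \<Rightarrow> nat) \<Rightarrow> nat \<Rightarrow> nat pmf" where
  "deterministic_policy f \<equiv> (\<lambda>s. return_pmf (f s))"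

definition lcb_penalty :: "real \<Rightarrow> real \<Rightarrow> nat \<Rightarrow> nat \<Rightarrow> nat \<Rightarrow> real \<Rightarrow> nat \<Rightarrow> real" where
  "lcb_penalty c_b V q S A \<delta> m = c_b * sqrt (V\<^sup>2 * (ln (real (S * A) / \<delta>)) ^ q / real m)"

end

theory Submission
  imports Defs
begin

text \<open>
  On the event that no rating average of a suboptimal pair exceeds its mean by more than the
  penalty, and that every covered optimal pair \<open>(s, a)\<close> is visited at least \<open>n d(s, a) / 2\<close> times
  with a noise of the order of the penalty, the chosen action has mean rating at least that of the
  optimal one minus a multiple of \<open>sqrt (V\<^sup>2 L ^ q / (n d(s, a)))\<close>, where \<open>L = ln (S A / \<delta>)\<close>;
  the first regularity condition on the mean rating turns this into a bound on the reward gap.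

  The noise of a pair is, given all sampled pairs, a sum of \<open>m\<close> i.i.d. symmetric polynomials of
  degree \<open>q\<close> in Gaussians. Expanding in Hermite polynomials bounds the \<open>2k\<close>-th moment of one summand
  by \<open>2 (V\<^sup>2 (50 k) ^ q) ^ k\<close>, and comparison with a Gaussian of suitable variance transfers this to the
  sum. Since a moment of order proportional to \<open>L\<close> has a base \<open>(50 k / L) ^ q \<le> 1\<close>, the constant in the
  penalty need not depend on \<open>q\<close>. This fails only for \<open>L < 1\<close>, which leaves one state and two actions;
  there the symmetry of the noise suffices.
\<close>

section \<open>Gaussian moments of polynomials\<close>

text \<open>The order of the quantifiers is the obstacle: the penalty constant is fixed before the
  degree \<open>q\<close>, whereas the constant of the final bound may depend on it. Deviations are
  therefore treated asymmetrically. An upward deviation of a suboptimal pair has to be absorbed by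
  the penalty, so its control must be free of \<open>q\<close>. A deviation of an optimal pair only
  enlarges the final bound, so there a factor such as \<open>2 ^ q\<close> is admissible. Choosing
  an overrated action that is itself optimal costs nothing. Symmetry of the noise has two uses: it
  removes the odd moments, which leaves a recursion among even moments alone, and it gives the
  one-sided bound one half, whose threshold is zero and hence insensitive to a tiny penalty.\<close>

fun hermite :: "nat \<Rightarrow> real poly" where
  "hermite 0 = 1"
| "hermite (Suc n) = pCons 0 (hermite n) - pderiv (hermite n)"

lemma pderiv_hermite_Suc: "pderiv (hermite (Suc n)) = smult (real (Suc n)) (hermite n)"
proof (induction n)
  case 0
  show ?case by (simp add: pderiv_pCons one_pCons)
next
  case (Suc n)
  have "pderiv (hermite (Suc (Suc n))) =
      hermite (Suc n) + pCons 0 (pderiv (hermite (Suc n))) - pderiv (pderiv (hermite (Suc n)))"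
    by (simp add: pderiv_pCons pderiv_diff pderiv_add)
  also have "\<dots> = hermite (Suc n) + smult (real (Suc n)) (pCons 0 (hermite n) - pderiv (hermite n))"
    unfolding Suc.IH by (simp add: pderiv_smult smult_diff_right del: of_nat_Suc)
  also have "\<dots> = smult (real (Suc (Suc n))) (hermite (Suc n))"
    using smult_add_left[of 1 "real (Suc n)" "hermite (Suc n)"] by (simp only: hermite.simps) simp
  finally show ?case .
qed

lemma degree_hermite_le: "degree (hermite n) \<le> n"
proof (induction n)
  case (Suc n)
  have "degree (pCons 0 (hermite n)) \<le> Suc n"
    using Suc by (meson degree_pCons_le le_trans not_less_eq_eq)
  moreover have "degree (pderiv (hermite n)) \<le> Suc n"
    using Suc by (simp add: degree_pderiv)
  ultimately show ?case
    by (simp add: degree_diff_le)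
qed simp

lemma coeff_hermite: "coeff (hermite n) n = 1"
proof (induction n)
  case (Suc n)
  then show ?case
    using degree_hermite_le[of n] by (simp add: coeff_pderiv coeff_eq_0)
qed simp

text \<open>Leading coefficients are one, so subtracting a multiple of the top Hermite polynomial
  lowers the degree.\<close>

lemma hermite_expansion:
  assumes "degree p \<le> q"
  obtains c where "p = (\<Sum>n\<le>q. smult (c n) (hermite n))"
proof -
  have "\<exists>c. p = (\<Sum>n\<le>q. smult (c n) (hermite n))"
    using assms
  proof (induction q arbitrary: p)
    case 0
    then have "p = smult (coeff p 0) (hermite 0)"
      by (auto elim!: degree_eq_zeroE)
    then show ?case by (intro exI[of _ "\<lambda>_. coeff p 0"]) simp
  next
    case (Suc q)
    define a where "a = coeff p (Suc q)"
    define p' where "p' = p - smult a (hermite (Suc q))"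
    have "degree p' \<le> q"
    proof (rule degree_le, intro allI impI)
      fix i assume i: "q < i"
      show "coeff p' i = 0"
      proof (cases "i = Suc q")
        case True
        then show ?thesis
          using coeff_hermite[of "Suc q"] by (simp add: p'_def a_def del: hermite.simps)
      next
        case False
        then have "Suc q < i" using i by simp
        then show ?thesis
          using Suc.prems degree_hermite_le[of "Suc q"]
          by (simp add: p'_def coeff_eq_0 del: hermite.simps)
      qed
    qed
    from Suc.IH[OF this] obtain c where c: "p' = (\<Sum>n\<le>q. smult (c n) (hermite n))" by blast
    have "p = p' + smult a (hermite (Suc q))" by (simp add: p'_def)
    also have "\<dots> = (\<Sum>n\<le>Suc q. smult ((c(Suc q := a)) n) (hermite n))"
      unfolding c by (simp del: hermite.simps)
    finally show ?case by blast
  qed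
  then show thesis using that by blast
qed

text \<open>The three-term recurrence \<open>He_n = x He_(n-1) - (n-1) He_(n-2)\<close> preserves
  the bound, since \<open>y = |x| + sqrt n\<close> satisfies
  \<open>|x| y + (n - 1) <= y^2\<close>.\<close>

lemma abs_poly_hermite_le: "\<bar>poly (hermite n) x\<bar> \<le> (\<bar>x\<bar> + sqrt n) ^ n"
proof (induction n rule: less_induct)
  case (less n)
  show ?case
  proof (cases n)
    case 0
    then show ?thesis by simp
  next
    case (Suc m)
    show ?thesis
    proof (cases m)
      case 0
      then show ?thesis using Suc by simp
    next
      case (Suc l)
      note n = \<open>n = Suc m\<close> \<open>m = Suc l\<close>
      define y where "y = \<bar>x\<bar> + sqrt n"
      have mono: "(\<bar>x\<bar> + sqrt i) ^ j \<le> y ^ j" if "i \<le> n" for i j :: nat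
        using that by (intro power_mono) (auto simp: y_def)
      have "poly (hermite n) x = x * poly (hermite m) x - real m * poly (hermite l) x"
        unfolding n hermite.simps(2)[of "Suc l"] pderiv_hermite_Suc by simp
      then have "\<bar>poly (hermite n) x\<bar> \<le> \<bar>x\<bar> * \<bar>poly (hermite m) x\<bar> + real m * \<bar>poly (hermite l) x\<bar>"
        using abs_triangle_ineq4[of "x * poly (hermite m) x" "real m * poly (hermite l) x"]
        by (simp add: abs_mult)
      also have "\<dots> \<le> \<bar>x\<bar> * y ^ m + real m * y ^ l"
        using less.IH[of m] less.IH[of l] mono[of m m] mono[of l l] n
        by (intro add_mono mult_left_mono) auto
      also have "\<dots> = y ^ l * (\<bar>x\<bar> * y + real m)"
        using n by (simp add: algebra_simps)
      also have "\<dots> \<le> y ^ l * (y * y)"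
      proof (rule mult_left_mono)
        have "real m \<le> sqrt n * sqrt n" using n by simp
        also have "\<dots> \<le> sqrt n * y" by (intro mult_left_mono) (auto simp: y_def)
        finally show "\<bar>x\<bar> * y + real m \<le> y * y"
          by (simp add: y_def algebra_simps)
      qed (simp add: y_def)
      also have "\<dots> = y ^ n" using n by simp
      finally show ?thesis by (simp add: y_def)
    qed
  qed
qed

lemma power_div_fact_le_exp:
  fixes x :: real
  assumes "0 \<le> x"
  shows "x ^ n / fact n \<le> exp x"
proof -
  have "(\<Sum>i\<in>{n}. inverse (fact i) * x ^ i) \<le> (\<Sum>i. inverse (fact i) * x ^ i)"
    using assms by (intro sum_le_suminf) (auto intro: summable_exp)
  then show ?thesis
    by (simp add: exp_def field_simps)
qed

text \<open>Dividing by \<open>fact n\<close> normalises \<open>hermite n\<close> to second moment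
  one. The estimate \<open>u^n / n! <= exp u\<close> is applied to
  \<open>u = (x^2 + n) / (4 k)\<close>; the scale \<open>4 k\<close> is chosen so that the
  \<open>k\<close>-th power of the remaining weight is \<open>exp (x^2 / 4)\<close>, which is still
  integrable against the standard Gaussian.\<close>

lemma hermite_square_div_fact_le:
  assumes "1 \<le> k" and "n \<le> q"
  shows "(poly (hermite n) x)\<^sup>2 / fact n \<le> (8 * exp 1 * real k) ^ q * exp (x\<^sup>2 / (4 * real k))"
proof -
  define a where "a = 4 * real k"
  have a: "1 \<le> a" using assms by (simp add: a_def)
  have "(poly (hermite n) x)\<^sup>2 \<le> ((\<bar>x\<bar> + sqrt n) ^ n)\<^sup>2"
    by (rule abs_le_square_iff[THEN iffD1]) (use abs_poly_hermite_le[of n x] in auto)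
  also have "\<dots> = ((\<bar>x\<bar> + sqrt n)\<^sup>2) ^ n" by (simp add: power_mult[symmetric] mult.commute)
  also have "\<dots> \<le> (2 * (x\<^sup>2 + n)) ^ n"
  proof (rule power_mono)
    show "(\<bar>x\<bar> + sqrt n)\<^sup>2 \<le> 2 * (x\<^sup>2 + n)"
      using sum_squares_bound[of "\<bar>x\<bar>" "sqrt n"] by (simp add: power2_sum)
  qed simp
  also have "\<dots> = (2 * a) ^ n * ((x\<^sup>2 + n) / a) ^ n"
    unfolding power_mult_distrib[symmetric] using a by simp
  finally have "(poly (hermite n) x)\<^sup>2 / fact n \<le> (2 * a) ^ n * (((x\<^sup>2 + n) / a) ^ n / fact n)"
    by (simp add: divide_right_mono)
  also have "\<dots> \<le> (2 * a) ^ n * exp ((x\<^sup>2 + n) / a)"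
    using a by (intro mult_left_mono power_div_fact_le_exp) auto
  also have "\<dots> = (2 * a) ^ n * (exp (n / a) * exp (x\<^sup>2 / a))"
    by (simp add: add_divide_distrib exp_add)
  also have "\<dots> \<le> (2 * a) ^ n * (exp n * exp (x\<^sup>2 / a))"
    using a by (intro mult_left_mono mult_right_mono) (auto simp: divide_le_eq mult_le_cancel_left1)
  also have "\<dots> = (8 * exp 1 * real k) ^ n * exp (x\<^sup>2 / a)"
    by (simp add: a_def power_mult_distrib exp_of_nat_mult[symmetric] mult_ac)
  also have "\<dots> \<le> (8 * exp 1 * real k) ^ q * exp (x\<^sup>2 / a)"
  proof (intro mult_right_mono power_increasing)
    have "1 * 1 * 1 \<le> 8 * exp 1 * real k"
      using assms by (intro mult_mono) auto
    then show "1 \<le> 8 * exp 1 * real k" by simp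
  qed (use assms in auto)
  finally show ?thesis by (simp add: a_def)
qed

section \<open>Moments of the Gaussian noise\<close>

lemma prob_space_noise: "0 < \<sigma> \<Longrightarrow> prob_space (noise \<sigma>)"
  unfolding noise_def by (rule prob_space_normal_density)

lemma sets_noise [simp, measurable_cong]: "sets (noise \<sigma>) = sets borel"
  by (simp add: noise_def)

lemma space_noise [simp]: "space (noise \<sigma>) = UNIV"
  by (simp add: noise_def)

lemma borel_measurable_poly [measurable]: "(\<lambda>x. poly p x :: real) \<in> borel_measurable borel"
  by (intro borel_measurable_continuous_onI continuous_intros)

lemma integrable_power_noise:
  assumes "0 < \<sigma>"
  shows "integrable (noise \<sigma>) (\<lambda>x. x ^ i)"
  using integrable_normal_moment[OF assms, of 0 i]
  by (simp add: noise_def integrable_density)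

lemma integrable_poly_noise:
  assumes "0 < \<sigma>"
  shows "integrable (noise \<sigma>) (poly p)"
proof -
  have "integrable (noise \<sigma>) (\<lambda>x. \<Sum>i\<le>degree p. coeff p i * x ^ i)"
    by (intro Bochner_Integration.integrable_sum integrable_mult_right integrable_power_noise assms)
  then show ?thesis by (simp add: poly_altdef[abs_def])
qed

text \<open>The double factorial (2k-1)!!, which is the moment of order \<open>2 k\<close> of the
  standard Gaussian.\<close>

definition odd_double_fact :: "nat \<Rightarrow> real" where
  "odd_double_fact k = fact (2 * k) / (2 ^ k * fact k)"

lemma odd_double_fact_0 [simp]: "odd_double_fact 0 = 1"
  by (simp add: odd_double_fact_def)

lemma odd_double_fact_Suc [simp]: "odd_double_fact (Suc k) = real (2 * k + 1) * odd_double_fact k"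
  by (simp add: odd_double_fact_def divide_simps)

lemma std_gaussian_moment_0: "(\<integral>x. x ^ 0 \<partial>noise 1) = 1"
  using prob_space.prob_space[OF prob_space_noise[of 1]] by simp

lemma std_gaussian_moment_1: "(\<integral>x. x ^ 1 \<partial>noise 1) = 0"
  using integral_std_normal_moment_odd[of 0]
  by (simp add: noise_def integral_density)

text \<open>One recursion for both parities, so that integration by parts needs no case split; for
  odd orders both sides vanish.\<close>

lemma std_gaussian_moment_Suc_Suc:
  "(\<integral>x. x ^ Suc (Suc i) \<partial>noise 1) = real (Suc i) * (\<integral>x. x ^ i \<partial>noise 1)"
proof (cases "even i")
  case True
  then obtain j where j: "i = 2 * j" by blast
  have "(\<integral>x. x ^ (2 * l) \<partial>noise 1) = odd_double_fact l" for l
    using integral_std_normal_moment_even[of l]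
    by (simp add: noise_def integral_density odd_double_fact_def)
  from this[of j] this[of "Suc j"] show ?thesis
    by (simp add: j)
next
  case False
  then obtain j where j: "i = 2 * j + 1" by (blast elim: oddE)
  have "(\<integral>x. x ^ (2 * l + 1) \<partial>noise 1) = 0" for l
    using integral_std_normal_moment_odd[of l] by (simp add: noise_def integral_density)
  from this[of j] this[of "Suc j"] show ?thesis
    by (simp add: j)
qed

section \<open>Gaussian integration by parts and Hermite orthogonality\<close>

text \<open>Taken as a linear functional on formal polynomials, so that multiplication by
  \<open>x\<close> and differentiation are algebraic operations.\<close>

definition gmean :: "real poly \<Rightarrow> real" where
  "gmean p = (\<integral>x. poly p x \<partial>noise 1)"

lemma gmean_add: "gmean (p + q) = gmean p + gmean q"
  by (simp add: gmean_def integrable_poly_noise)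

lemma gmean_diff: "gmean (p - q) = gmean p - gmean q"
  by (simp add: gmean_def integrable_poly_noise)

lemma gmean_smult: "gmean (smult c p) = c * gmean p"
  by (simp add: gmean_def)

lemma gmean_sum: "gmean (\<Sum>i\<in>I. f i) = (\<Sum>i\<in>I. gmean (f i))"
proof (induction I rule: infinite_finite_induct)
  case (insert i I)
  then show ?case by (simp add: gmean_add)
qed (simp_all add: gmean_def)

text \<open>Stein's identity \<open>E[X p(X)] = E[p'(X)]\<close>. Linearity reduces it to monomials,
  where it is the moment recursion.\<close>

lemma gmean_pCons_0: "gmean (pCons 0 p) = gmean (pderiv p)"
proof -
  have gmean_monom: "gmean (monom c i) = c * (\<integral>x. x ^ i \<partial>noise 1)" for c i
    by (simp add: gmean_def poly_monom)
  have monom: "gmean (pCons 0 (monom c i)) = gmean (pderiv (monom c i))" for c i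
  proof (cases i)
    case 0
    then show ?thesis
      using std_gaussian_moment_1 by (simp add: monom_Suc[symmetric] gmean_monom pderiv_monom) (simp add: gmean_def)
  next
    case (Suc j)
    then show ?thesis
      unfolding monom_Suc[symmetric] Suc pderiv_monom gmean_monom std_gaussian_moment_Suc_Suc
      by simp
  qed
  have "pCons 0 (\<Sum>i\<in>I. f i) = (\<Sum>i\<in>I. pCons 0 (f i))" for I and f :: "nat \<Rightarrow> real poly"
  proof (induction I rule: infinite_finite_induct)
    case (insert i I)
    have "pCons 0 (f i + sum f I) = pCons 0 (f i) + pCons 0 (sum f I)" by simp
    then show ?case using insert by simp
  qed simp_all
  from this[of "\<lambda>i. monom (coeff p i) i" "{..degree p}"]
  have "gmean (pCons 0 p) = gmean (\<Sum>i\<le>degree p. pCons 0 (monom (coeff p i) i))"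
    by (simp only: poly_as_sum_of_monoms)
  also have "\<dots> = gmean (\<Sum>i\<le>degree p. pderiv (monom (coeff p i) i))"
    by (simp add: gmean_sum monom)
  also have "(\<Sum>i\<le>degree p. pderiv (monom (coeff p i) i)) = pderiv (\<Sum>i\<le>degree p. monom (coeff p i) i)"
    using higher_pderiv_sum[of 1 "\<lambda>i. monom (coeff p i) i" "{..degree p}"] by simp
  also have "\<dots> = pderiv p"
    by (simp only: poly_as_sum_of_monoms)
  finally show ?thesis .
qed

text \<open>The operator that produces \<open>hermite (Suc n)\<close> from \<open>hermite n\<close>
  is the adjoint of differentiation: in Stein's identity for \<open>hermite n * p\<close> the
  product rule yields a term that cancels the subtracted derivative.\<close>

lemma gmean_hermite_Suc_mult: "gmean (hermite (Suc n) * p) = gmean (hermite n * pderiv p)"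
proof -
  have "hermite (Suc n) * p = pCons 0 (hermite n * p) - pderiv (hermite n) * p"
    by (simp add: algebra_simps)
  then show ?thesis
    by (simp add: gmean_diff gmean_pCons_0 pderiv_mult gmean_add mult.commute del: hermite.simps)
qed

text \<open>Adjointness moves a derivative onto the other factor, where it lowers the index as well;
  unequal indices end with the derivative of a constant.\<close>

lemma gmean_hermite_mult: "gmean (hermite m * hermite n) = (if m = n then fact n else 0)"
proof (induction m arbitrary: n)
  case 0
  show ?case
  proof (cases n)
    case 0
    then show ?thesis using std_gaussian_moment_0 by (simp add: gmean_def)
  next
    case (Suc j)
    then show ?thesis using gmean_hermite_Suc_mult[of j 1] by (simp add: gmean_def mult.commute del: hermite.simps(2))
  qed
next
  case (Suc m)
  show ?case
  proof (cases n)
    case 0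
    then show ?thesis using gmean_hermite_Suc_mult[of m 1] by (simp add: gmean_def mult.commute del: hermite.simps(2))
  next
    case (Suc j)
    then show ?thesis
      by (simp add: gmean_hermite_Suc_mult pderiv_hermite_Suc gmean_smult Suc.IH del: hermite.simps)
  qed
qed

lemma gmean_square_hermite_expansion:
  assumes "p = (\<Sum>n\<le>q. smult (c n) (hermite n))"
  shows "gmean (p * p) = (\<Sum>n\<le>q. (c n)\<^sup>2 * fact n)"
proof -
  have "gmean (p * p) = (\<Sum>m\<le>q. \<Sum>n\<le>q. c m * (c n * gmean (hermite m * hermite n)))"
    by (simp add: assms sum_product gmean_sum gmean_smult mult_ac)
  also have "\<dots> = (\<Sum>n\<le>q. (c n)\<^sup>2 * fact n)"
    by (simp add: gmean_hermite_mult if_distrib power2_eq_square mult.assoc cong: if_cong)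
  finally show ?thesis .
qed

section \<open>Higher moments of a polynomial from its second moment\<close>

text \<open>Cauchy-Schwarz against the orthonormal system \<open>hermite n / sqrt (fact n)\<close>,
  used in place of hypercontractivity. The \<open>q + 1\<close> terms cost \<open>2 ^ q\<close>, and
  \<open>16 * exp 1 <= 48\<close> is rounded up to 50.\<close>

lemma poly_square_le_gmean:
  assumes deg: "degree p \<le> q" and k: "1 \<le> k"
  shows "(poly p x)\<^sup>2 \<le> gmean (p * p) * (50 * real k) ^ q * exp (x\<^sup>2 / (4 * real k))"
proof -
  obtain c where c: "p = (\<Sum>n\<le>q. smult (c n) (hermite n))"
    using hermite_expansion[OF deg] by blast
  define B where "B = (8 * exp 1 * real k) ^ q * exp (x\<^sup>2 / (4 * real k))"
  have nonneg: "0 \<le> gmean (p * p)"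
    unfolding gmean_square_hermite_expansion[OF c] by (intro sum_nonneg) simp
  have "16 * exp 1 * real k = 2 * (8 * exp 1 * real k)" by simp
  then have pow: "(16 * exp 1 * real k) ^ q = 2 ^ q * (8 * exp 1 * real k) ^ q"
    by (simp only: power_mult_distrib)
  have "(poly p x)\<^sup>2 = (\<Sum>n\<le>q. (c n * sqrt (fact n)) * (poly (hermite n) x / sqrt (fact n)))\<^sup>2"
    by (simp add: c poly_sum)
  also have "\<dots> \<le> (\<Sum>n\<le>q. (c n * sqrt (fact n))\<^sup>2) * (\<Sum>n\<le>q. (poly (hermite n) x / sqrt (fact n))\<^sup>2)"
    by (rule Cauchy_Schwarz_ineq_sum)
  also have "\<dots> = gmean (p * p) * (\<Sum>n\<le>q. (poly (hermite n) x)\<^sup>2 / fact n)"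
    by (simp add: gmean_square_hermite_expansion[OF c] power_mult_distrib power_divide)
  also have "\<dots> \<le> gmean (p * p) * (\<Sum>n\<le>q. B)"
    using nonneg hermite_square_div_fact_le[OF k]
    by (intro mult_left_mono sum_mono) (simp_all add: B_def)
  also have "\<dots> \<le> gmean (p * p) * (2 ^ q * B)"
  proof (intro mult_left_mono)
    have "Suc q \<le> 2 ^ q" by (simp add: Suc_leI)
    then have "real (Suc q) \<le> 2 ^ q" by (metis of_nat_le_iff of_nat_numeral of_nat_power)
    then show "(\<Sum>n\<le>q. B) \<le> 2 ^ q * B"
      by (simp add: B_def mult_right_mono)
  qed (rule nonneg)
  also have "\<dots> = gmean (p * p) * (16 * exp 1 * real k) ^ q * exp (x\<^sup>2 / (4 * real k))"
    unfolding pow B_def by (simp only: mult.assoc)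
  also have "\<dots> \<le> gmean (p * p) * (50 * real k) ^ q * exp (x\<^sup>2 / (4 * real k))"
  proof -
    have "16 * exp 1 * real k \<le> 50 * real k"
      by (rule mult_right_mono) (use exp_le in auto)
    then have "(16 * exp 1 * real k) ^ q \<le> (50 * real k) ^ q"
      by (rule power_mono) simp
    then show "gmean (p * p) * (16 * exp 1 * real k) ^ q * exp (x\<^sup>2 / (4 * real k))
        \<le> gmean (p * p) * (50 * real k) ^ q * exp (x\<^sup>2 / (4 * real k))"
      using nonneg by (intro mult_right_mono mult_left_mono) simp_all
  qed
  finally show ?thesis .
qed

lemma distr_noise_scale:
  assumes "0 < \<sigma>"
  shows "distr (noise 1) borel (\<lambda>x. \<sigma> * x) = noise \<sigma>"
proof -
  interpret prob_space "noise 1" by (rule prob_space_noise) simp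
  have "distributed (noise 1) lborel (\<lambda>x. x) (normal_density 0 1)"
    unfolding distributed_def
    by (auto simp: noise_def measurable_ident_sets cong: distr_cong intro!: distr_id2)
  from normal_density_affine[OF this, of \<sigma> 0] show ?thesis
    using assms by (simp add: distributed_def noise_def cong: distr_cong)
qed

lemma integral_noise_scale:
  fixes f :: "real \<Rightarrow> real"
  assumes "0 < \<sigma>" and [measurable]: "f \<in> borel_measurable borel"
  shows "(\<integral>x. f x \<partial>noise \<sigma>) = (\<integral>x. f (\<sigma> * x) \<partial>noise 1)"
  by (subst distr_noise_scale[OF assms(1), symmetric]) (simp add: integral_distr)

lemma poly_square_le_noise:
  assumes \<sigma>: "0 < \<sigma>" and deg: "degree p \<le> q" and k: "1 \<le> k"
  shows "(poly p x)\<^sup>2 \<le>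
    (\<integral>x. (poly p x)\<^sup>2 \<partial>noise \<sigma>) * (50 * real k) ^ q * exp ((x / \<sigma>)\<^sup>2 / (4 * real k))"
proof -
  define p' where "p' = pcompose p [:0, \<sigma>:]"
  have p': "poly p' y = poly p (\<sigma> * y)" for y
    by (simp add: p'_def poly_pcompose mult.commute)
  have "degree p' \<le> q"
    using deg degree_pcompose_le[of p "[:0, \<sigma>:]"] \<sigma> by (simp add: p'_def)
  moreover have "gmean (p' * p') = (\<integral>x. (poly p x)\<^sup>2 \<partial>noise \<sigma>)"
    by (subst integral_noise_scale[OF \<sigma>]) (auto simp: gmean_def p' power2_eq_square)
  ultimately show ?thesis
    using poly_square_le_gmean[of p' q k "x / \<sigma>"] k \<sigma> by (simp add: p')
qed

text \<open>Multiplying the density of variance \<open>\<sigma>^2\<close> by this weight gives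
  \<open>sqrt 2\<close> times the density of variance \<open>2 * \<sigma>^2\<close>.\<close>

lemma exp_square_noise:
  assumes "0 < \<sigma>"
  shows "integrable (noise \<sigma>) (\<lambda>x. exp ((x / \<sigma>)\<^sup>2 / 4))"
    and "(\<integral>x. exp ((x / \<sigma>)\<^sup>2 / 4) \<partial>noise \<sigma>) = sqrt 2"
proof -
  have eq: "normal_density 0 \<sigma> x * exp ((x / \<sigma>)\<^sup>2 / 4) = sqrt 2 * normal_density 0 (sqrt 2 * \<sigma>) x" for x
    using assms
    by (simp add: normal_density_def exp_add[symmetric] power_mult_distrib real_sqrt_mult field_simps)
  have pos: "0 < sqrt 2 * \<sigma>" using assms by simp
  show "integrable (noise \<sigma>) (\<lambda>x. exp ((x / \<sigma>)\<^sup>2 / 4))"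
    unfolding noise_def using pos
    by (subst integrable_density) (auto simp: eq integrable_normal_density)
  show "(\<integral>x. exp ((x / \<sigma>)\<^sup>2 / 4) \<partial>noise \<sigma>) = sqrt 2"
    unfolding noise_def using pos
    by (subst integral_density) (auto simp: eq integral_normal_density)
qed

text \<open>The pointwise bound is raised to the power \<open>k\<close>. Its weight thereby loses
  the dependence on \<open>k\<close>, so that integrating it costs only
  \<open>sqrt 2 <= 2\<close>.\<close>

lemma poly_moment_noise:
  assumes \<sigma>: "0 < \<sigma>" and deg: "degree p \<le> q" and k: "1 \<le> k"
    and V: "(\<integral>x. (poly p x)\<^sup>2 \<partial>noise \<sigma>) \<le> V\<^sup>2"
  shows "(\<integral>x. (poly p x) ^ (2 * k) \<partial>noise \<sigma>) \<le> 2 * (V\<^sup>2 * (50 * real k) ^ q) ^ k"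
proof -
  have le: "(poly p x) ^ (2 * k) \<le> (V\<^sup>2 * (50 * real k) ^ q) ^ k * exp ((x / \<sigma>)\<^sup>2 / 4)" for x
  proof -
    have "(poly p x)\<^sup>2 \<le> V\<^sup>2 * (50 * real k) ^ q * exp ((x / \<sigma>)\<^sup>2 / (4 * real k))"
      using poly_square_le_noise[OF \<sigma> deg k, of x] V
      by (elim order_trans) (intro mult_right_mono; simp)
    then have "((poly p x)\<^sup>2) ^ k \<le> (V\<^sup>2 * (50 * real k) ^ q * exp ((x / \<sigma>)\<^sup>2 / (4 * real k))) ^ k"
      by (intro power_mono) auto
    also have "\<dots> = (V\<^sup>2 * (50 * real k) ^ q) ^ k * exp (real k * ((x / \<sigma>)\<^sup>2 / (4 * real k)))"
      by (simp only: power_mult_distrib exp_of_nat_mult)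
    also have "real k * ((x / \<sigma>)\<^sup>2 / (4 * real k)) = (x / \<sigma>)\<^sup>2 / 4"
      using k by simp
    finally show ?thesis by (simp add: power_mult)
  qed
  have "(\<integral>x. (poly p x) ^ (2 * k) \<partial>noise \<sigma>)
      \<le> (\<integral>x. (V\<^sup>2 * (50 * real k) ^ q) ^ k * exp ((x / \<sigma>)\<^sup>2 / 4) \<partial>noise \<sigma>)"
  proof (rule integral_mono)
    show "integrable (noise \<sigma>) (\<lambda>x. poly p x ^ (2 * k))"
      using integrable_poly_noise[OF \<sigma>, of "p ^ (2 * k)"] by (simp add: poly_power[abs_def])
  qed (use le exp_square_noise[OF \<sigma>] in simp_all)
  also have "\<dots> = (V\<^sup>2 * (50 * real k) ^ q) ^ k * sqrt 2"
    by (simp add: exp_square_noise[OF \<sigma>])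
  also have "\<dots> \<le> (V\<^sup>2 * (50 * real k) ^ q) ^ k * 2"
    by (intro mult_left_mono real_le_lsqrt) simp_all
  finally show ?thesis by simp
qed

section \<open>Double factorials and even moments of independent sums\<close>

lemma odd_double_fact_pos: "0 < odd_double_fact k"
  by (simp add: odd_double_fact_def)

lemma fact_le_odd_double_fact: "fact k \<le> odd_double_fact k"
proof (induction k)
  case (Suc k)
  have "fact (Suc k) = real (Suc k) * fact k" by simp
  also have "\<dots> \<le> real (2 * k + 1) * odd_double_fact k"
    using Suc by (intro mult_mono) auto
  finally show ?case by (simp only: odd_double_fact_Suc)
qed simp

lemma odd_double_fact_le: "odd_double_fact k \<le> (2 * real k) ^ k"
proof -
  have "odd_double_fact j \<le> (2 * real k) ^ j" if "j \<le> k" for j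
    using that
  proof (induction j)
    case (Suc j)
    have "real (2 * j + 1) * odd_double_fact j \<le> 2 * real k * (2 * real k) ^ j"
      using Suc odd_double_fact_pos[of j] by (intro mult_mono) auto
    then show ?case by simp
  qed simp
  then show ?thesis by simp
qed

text \<open>Trades the growth \<open>j ^ j\<close> in a moment of a polynomial for a Gaussian
  moment; the exponential factor can be absorbed into a variance.\<close>

lemma power_self_le: "real j ^ j \<le> exp (real j) * odd_double_fact j"
proof -
  have "real j ^ j \<le> exp (real j) * fact j"
    using power_div_fact_le_exp[of "real j" j] by (simp add: field_simps)
  also have "\<dots> \<le> exp (real j) * odd_double_fact j"
    using fact_le_odd_double_fact by (intro mult_left_mono) auto
  finally show ?thesis .
qed

text \<open>The coefficient identity by which the moments of independent centred Gaussians of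
  variances \<open>v\<close> and \<open>w\<close> recombine, through the binomial theorem, into
  those of variance \<open>v + w\<close>.\<close>

lemma binomial_odd_double_fact:
  assumes "l \<le> j"
  shows "real ((2 * j) choose (2 * l)) * odd_double_fact l * odd_double_fact (j - l)
    = odd_double_fact j * real (j choose l)"
proof -
  have "2 ^ j = (2 ^ l * 2 ^ (j - l) :: real)"
    using assms by (simp add: power_add[symmetric])
  moreover have "2 * j - 2 * l = 2 * (j - l)" by simp
  ultimately show ?thesis
    using assms by (simp add: binomial_fact odd_double_fact_def)
qed

lemma sum_even_indices:
  fixes f :: "nat \<Rightarrow> 'a :: comm_monoid_add"
  assumes "\<And>i. odd i \<Longrightarrow> f i = 0"
  shows "(\<Sum>i\<le>2 * j. f i) = (\<Sum>l\<le>j. f (2 * l))"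
proof -
  have "(\<Sum>i\<le>2 * j. f i) = sum f ((*) 2 ` {..j})"
  proof (intro sum.mono_neutral_right ballI)
    fix i assume "i \<in> {..2 * j} - (*) 2 ` {..j}"
    then have "odd i" by (auto elim!: evenE)
    then show "f i = 0" by (rule assms)
  qed auto
  also have "\<dots> = (\<Sum>l\<le>j. f (2 * l))"
    by (subst sum.reindex) (auto simp: inj_on_def)
  finally show ?thesis .
qed

text \<open>The binomial recursion for the moments of a sum is an equality for Gaussians, whence the comparison.\<close>

lemma (in prob_space) even_moment_sum_le:
  fixes X :: "'i \<Rightarrow> 'a \<Rightarrow> real"
  assumes "finite I" and "indep_vars (\<lambda>_. borel) X I" and v: "0 \<le> v"
    and int: "\<And>i j. i \<in> I \<Longrightarrow> integrable M (\<lambda>\<omega>. X i \<omega> ^ j)"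
    and odd: "\<And>i j. i \<in> I \<Longrightarrow> odd j \<Longrightarrow> expectation (\<lambda>\<omega>. X i \<omega> ^ j) = 0"
    and even: "\<And>i j. i \<in> I \<Longrightarrow> j \<le> k \<Longrightarrow>
      expectation (\<lambda>\<omega>. X i \<omega> ^ (2 * j)) \<le> v ^ j * odd_double_fact j"
  shows "integrable M (\<lambda>\<omega>. (\<Sum>i\<in>I. X i \<omega>) ^ j)"
    and "j \<le> k \<Longrightarrow> expectation (\<lambda>\<omega>. (\<Sum>i\<in>I. X i \<omega>) ^ (2 * j))
      \<le> (real (card I) * v) ^ j * odd_double_fact j"
proof -
  have "(\<forall>j. integrable M (\<lambda>\<omega>. (\<Sum>i\<in>I. X i \<omega>) ^ j)) \<and>
    (\<forall>j\<le>k. expectation (\<lambda>\<omega>. (\<Sum>i\<in>I. X i \<omega>) ^ (2 * j))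
      \<le> (real (card I) * v) ^ j * odd_double_fact j)"
    using assms(1,2) int odd even
  proof (induction I rule: finite_induct)
    case empty
    then show ?case by (auto simp: power_0_left prob_space)
  next
    case (insert i I)
    define S where "S = (\<lambda>\<omega>. \<Sum>i\<in>I. X i \<omega>)"
    have "indep_vars (\<lambda>_. borel) X I"
      using insert.prems(1) by (rule indep_vars_subset) auto
    then have IH: "integrable M (\<lambda>\<omega>. S \<omega> ^ j)"
      "j \<le> k \<Longrightarrow> expectation (\<lambda>\<omega>. S \<omega> ^ (2 * j)) \<le> (real (card I) * v) ^ j * odd_double_fact j" for j
      using insert.IH insert.prems unfolding S_def by auto
    have indep: "indep_var borel (X i) borel S"
      unfolding S_def using insert.hyps insert.prems(1) by (intro indep_vars_sum) auto
    have indep_pow: "indep_var borel (\<lambda>\<omega>. X i \<omega> ^ a) borel (\<lambda>\<omega>. S \<omega> ^ b)" for a b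
      using indep_var_compose[OF indep, of "\<lambda>x. x ^ a" borel "\<lambda>x. x ^ b" borel] by (simp add: comp_def)
    have intX: "integrable M (\<lambda>\<omega>. X i \<omega> ^ a)" for a
      using insert.prems(2) by simp
    have int_prod: "integrable M (\<lambda>\<omega>. X i \<omega> ^ a * S \<omega> ^ b)" for a b
      by (rule indep_var_integrable[OF indep_pow intX IH(1)])
    have E_prod: "expectation (\<lambda>\<omega>. X i \<omega> ^ a * S \<omega> ^ b)
        = expectation (\<lambda>\<omega>. X i \<omega> ^ a) * expectation (\<lambda>\<omega>. S \<omega> ^ b)" for a b
      by (rule indep_var_lebesgue_integral[OF indep_pow intX IH(1)])
    have expand: "(\<Sum>i\<in>insert i I. X i \<omega>) ^ j
        = (\<Sum>l\<le>j. real (j choose l) * (X i \<omega> ^ l * S \<omega> ^ (j - l)))" for j \<omega>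
      using insert.hyps by (simp add: S_def binomial_ring mult.assoc)
    have "integrable M (\<lambda>\<omega>. (\<Sum>i\<in>insert i I. X i \<omega>) ^ j)" for j
      unfolding expand by (intro Bochner_Integration.integrable_sum integrable_mult_right int_prod)
    moreover have "expectation (\<lambda>\<omega>. (\<Sum>i\<in>insert i I. X i \<omega>) ^ (2 * j))
      \<le> (real (card (insert i I)) * v) ^ j * odd_double_fact j" if j: "j \<le> k" for j
    proof -
      let ?m = "real (card I)"
      have "expectation (\<lambda>\<omega>. (\<Sum>i\<in>insert i I. X i \<omega>) ^ (2 * j))
        = (\<Sum>l\<le>2 * j. real ((2 * j) choose l) *
             (expectation (\<lambda>\<omega>. X i \<omega> ^ l) * expectation (\<lambda>\<omega>. S \<omega> ^ (2 * j - l))))"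
        unfolding expand by (simp add: int_prod E_prod)
      \<comment> \<open>Odd moments of the new summand vanish. For an even order
        \<open>2 * l\<close> the complementary order of the partial sum is even too, so the
        induction has to bound even moments only.\<close>
      also have "\<dots> = (\<Sum>l\<le>j. real ((2 * j) choose (2 * l)) *
             (expectation (\<lambda>\<omega>. X i \<omega> ^ (2 * l)) * expectation (\<lambda>\<omega>. S \<omega> ^ (2 * (j - l)))))"
        using insert.prems(3)[of i] by (subst sum_even_indices) (auto simp: diff_mult_distrib2)
      also have "\<dots> \<le> (\<Sum>l\<le>j. real ((2 * j) choose (2 * l)) *
             ((v ^ l * odd_double_fact l) * ((?m * v) ^ (j - l) * odd_double_fact (j - l))))"
      proof (intro sum_mono mult_left_mono mult_mono)
        fix l assume l: "l \<in> {..j}"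
        show "expectation (\<lambda>\<omega>. X i \<omega> ^ (2 * l)) \<le> v ^ l * odd_double_fact l"
          using l j insert.prems(4)[of i l] by simp
        show "expectation (\<lambda>\<omega>. S \<omega> ^ (2 * (j - l))) \<le> (?m * v) ^ (j - l) * odd_double_fact (j - l)"
          using l j by (intro IH) simp
      qed (use v odd_double_fact_pos in \<open>auto intro!: mult_nonneg_nonneg simp: less_imp_le\<close>)
      also have "\<dots> = (\<Sum>l\<le>j. (real ((2 * j) choose (2 * l)) * odd_double_fact l * odd_double_fact (j - l))
             * (v ^ l * (?m * v) ^ (j - l)))"
        by (simp add: mult_ac)
      also have "\<dots> = odd_double_fact j * (\<Sum>l\<le>j. real (j choose l) * v ^ l * (?m * v) ^ (j - l))"
        unfolding sum_distrib_left
        by (intro sum.cong refl) (subst binomial_odd_double_fact; simp)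
      also have "\<dots> = odd_double_fact j * (v + ?m * v) ^ j"
        by (simp add: binomial_ring)
      also have "\<dots> = (real (card (insert i I)) * v) ^ j * odd_double_fact j"
        using insert.hyps by (simp add: algebra_simps)
      finally show ?thesis .
    qed
    ultimately show ?case by blast
  qed
  then show "integrable M (\<lambda>\<omega>. (\<Sum>i\<in>I. X i \<omega>) ^ j)"
    and "j \<le> k \<Longrightarrow> expectation (\<lambda>\<omega>. (\<Sum>i\<in>I. X i \<omega>) ^ (2 * j))
      \<le> (real (card I) * v) ^ j * odd_double_fact j" by blast+
qed

lemma (in prob_space) prob_square_gt_le:
  assumes int: "integrable M (\<lambda>\<omega>. S \<omega> ^ (2 * k))" and [measurable]: "S \<in> borel_measurable M"
    and t: "0 < t" and E: "expectation (\<lambda>\<omega>. S \<omega> ^ (2 * k)) \<le> B"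
  shows "prob {\<omega> \<in> space M. t < (S \<omega>)\<^sup>2} \<le> B / t ^ k"
proof -
  have "prob {\<omega> \<in> space M. t < (S \<omega>)\<^sup>2} \<le> prob {\<omega> \<in> space M. t ^ k \<le> S \<omega> ^ (2 * k)}"
    using t by (intro finite_measure_mono) (auto simp: power_mult power_mono)
  also have "\<dots> \<le> expectation (\<lambda>\<omega>. S \<omega> ^ (2 * k)) / t ^ k"
    by (rule integral_Markov_inequality_measure[OF int, of "{}"]) (use t in auto)
  also have "\<dots> \<le> B / t ^ k"
    using E t by (intro divide_right_mono) auto
  finally show ?thesis .
qed

section \<open>Tails of sums of symmetric polynomials in Gaussian noise\<close>

lemma prob_space_PiM_noise: "0 < \<sigma> \<Longrightarrow> prob_space (Pi\<^sub>M I (\<lambda>_. noise \<sigma>))"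
  by (intro prob_space_PiM prob_space_noise)

text \<open>Independence means that the joint law is the product of the marginals; the joint law of
  all coordinates is the product measure itself.\<close>

lemma indep_vars_PiM_coordinates:
  assumes "finite I" "\<And>i. i \<in> I \<Longrightarrow> prob_space (M i)"
  shows "prob_space.indep_vars (Pi\<^sub>M I M) M (\<lambda>i x. x i) I"
proof -
  interpret prob_space "Pi\<^sub>M I M" using assms by (intro prob_space_PiM) auto
  show ?thesis
  proof (cases "I = {}")
    case True
    then show ?thesis unfolding indep_vars_def indep_sets_def by auto
  next
    case False
    have "distr (Pi\<^sub>M I M) (Pi\<^sub>M I M) (\<lambda>x. \<lambda>i\<in>I. x i) = distr (Pi\<^sub>M I M) (Pi\<^sub>M I M) (\<lambda>x. x)"
      by (intro distr_cong) (auto simp: space_PiM)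
    also have "\<dots> = (\<Pi>\<^sub>M i\<in>I. distr (Pi\<^sub>M I M) (M i) (\<lambda>x. x i))"
      using assms by (simp add: distr_id) (intro PiM_cong; simp add: distr_PiM_component)
    finally show ?thesis
      using False by (subst indep_vars_iff_distr_eq_PiM') auto
  qed
qed

text \<open>The centred rating of one pair, isolated from the bandit. The bounds concern
  \<open>n\<close> independent noises and an arbitrary index set \<open>I\<close>, which later is
  the set of samples that hit the pair.\<close>

locale centred_symmetric_polynomial =
  fixes \<sigma> V :: real and p :: "real poly" and q n :: nat
  assumes \<sigma>: "0 < \<sigma>"
    and deg: "degree p \<le> q"
    and mean: "(\<integral>x. poly p x \<partial>noise \<sigma>) = 0"
    and var: "(\<integral>x. (poly p x)\<^sup>2 \<partial>noise \<sigma>) \<le> V\<^sup>2"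
    and sym: "distr (noise \<sigma>) borel (\<lambda>x. - poly p x) = distr (noise \<sigma>) borel (poly p)"
begin

abbreviation N :: "(nat \<Rightarrow> real) measure" where
  "N \<equiv> Pi\<^sub>M {..<n} (\<lambda>_. noise \<sigma>)"

sublocale noise: prob_space "noise \<sigma>" by (rule prob_space_noise[OF \<sigma>])
sublocale N: prob_space N by (rule prob_space_PiM_noise[OF \<sigma>])

lemma expectation_coordinate:
  fixes f :: "real \<Rightarrow> real"
  assumes "i < n" and [measurable]: "f \<in> borel_measurable borel"
  shows "N.expectation (\<lambda>e. f (e i)) = (\<integral>x. f x \<partial>noise \<sigma>)"
    and "integrable (noise \<sigma>) f \<Longrightarrow> integrable N (\<lambda>e. f (e i))"
proof -
  have d: "distr N (noise \<sigma>) (\<lambda>e. e i) = noise \<sigma>"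
    using assms prob_space_noise[OF \<sigma>] by (intro distr_PiM_component) auto
  have [measurable]: "(\<lambda>e. e i) \<in> N \<rightarrow>\<^sub>M noise \<sigma>" using assms by simp
  have f: "f \<in> borel_measurable (noise \<sigma>)" by simp
  show "N.expectation (\<lambda>e. f (e i)) = (\<integral>x. f x \<partial>noise \<sigma>)"
    by (subst (2) d[symmetric]) (simp add: integral_distr)
  show "integrable N (\<lambda>e. f (e i))" if "integrable (noise \<sigma>) f"
    using that by (subst (asm) d[symmetric]) (simp add: integrable_distr_eq)
qed

lemma measurable_coordinate: "i < n \<Longrightarrow> (\<lambda>e. e i) \<in> borel_measurable N"
  using measurable_component_singleton[of i "{..<n}" "\<lambda>_. noise \<sigma>"]
  by (simp cong: measurable_cong_sets)

lemma measurable_sum_poly: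
  assumes "I \<subseteq> {..<n}"
  shows "(\<lambda>e. \<Sum>i\<in>I. poly p (e i)) \<in> borel_measurable N"
  using assms
  by (intro borel_measurable_sum measurable_compose[OF measurable_coordinate borel_measurable_poly]) auto

text \<open>The law of \<open>poly p\<close> is invariant under negation, so the moment equals its
  own negative.\<close>

lemma odd_moment:
  assumes "odd j"
  shows "(\<integral>x. poly p x ^ j \<partial>noise \<sigma>) = 0"
proof -
  have "(\<integral>x. poly p x ^ j \<partial>noise \<sigma>) = (\<integral>y. y ^ j \<partial>distr (noise \<sigma>) borel (poly p))"
    by (simp add: integral_distr)
  also have "\<dots> = (\<integral>y. y ^ j \<partial>distr (noise \<sigma>) borel (\<lambda>x. - poly p x))"
    by (simp only: sym)
  also have "\<dots> = (\<integral>x. - (poly p x ^ j) \<partial>noise \<sigma>)"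
    using assms by (simp add: integral_distr)
  finally show ?thesis by simp
qed

text \<open>A constant of mean zero vanishes; for \<open>V = 0\<close> the pointwise bound by the
  second moment makes \<open>p\<close> vanish everywhere, not merely almost everywhere. These cases
  are split off because the tail estimates divide by a threshold containing \<open>V^2\<close> and
  separate one factor from a \<open>q\<close>-th power.\<close>

lemma poly_eq_0:
  assumes "V = 0 \<or> q = 0"
  shows "poly p x = 0"
proof (cases "q = 0")
  case True
  then have "degree p = 0" using deg by simp
  then obtain c where "p = [:c:]" by (rule degree_eq_zeroE)
  then show ?thesis using mean noise.prob_space by simp
next
  case False
  then have "(\<integral>x. (poly p x)\<^sup>2 \<partial>noise \<sigma>) \<le> 0" using var assms by simp
  then have "(\<integral>x. (poly p x)\<^sup>2 \<partial>noise \<sigma>) * (50 * real 1) ^ q * exp ((x / \<sigma>)\<^sup>2 / (4 * real 1)) \<le> 0"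
    by (intro mult_nonpos_nonneg) auto
  then have "(poly p x)\<^sup>2 \<le> 0"
    using poly_square_le_noise[OF \<sigma> deg, of 1 x] by linarith
  then show ?thesis by simp
qed

lemma even_moment_sum:
  assumes I: "I \<subseteq> {..<n}" and v: "0 \<le> v"
    and even: "\<And>j. j \<le> k \<Longrightarrow> (\<integral>x. poly p x ^ (2 * j) \<partial>noise \<sigma>) \<le> v ^ j * odd_double_fact j"
  shows "integrable N (\<lambda>e. (\<Sum>i\<in>I. poly p (e i)) ^ j)"
    and "N.expectation (\<lambda>e. (\<Sum>i\<in>I. poly p (e i)) ^ (2 * k))
      \<le> (real (card I) * v) ^ k * odd_double_fact k"
proof -
  have fin: "finite I" using I finite_subset by blast
  have "N.indep_vars (\<lambda>_. borel) (\<lambda>i e. poly p (e i)) {..<n}"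
    by (rule N.indep_vars_compose2[OF indep_vars_PiM_coordinates])
       (auto intro: prob_space_noise[OF \<sigma>])
  then have indep: "N.indep_vars (\<lambda>_. borel) (\<lambda>i e. poly p (e i)) I"
    using I by (rule N.indep_vars_subset)
  have int: "integrable N (\<lambda>e. poly p (e i) ^ j)" if "i \<in> I" for i j
    using integrable_poly_noise[OF \<sigma>, of "p ^ j"] that I
    by (intro expectation_coordinate(2)[of i "\<lambda>x. poly p x ^ j"]) (auto simp: poly_power[abs_def])
  have E: "N.expectation (\<lambda>e. poly p (e i) ^ j) = (\<integral>x. poly p x ^ j \<partial>noise \<sigma>)" if "i \<in> I" for i j
    using that I by (intro expectation_coordinate(1)[of i "\<lambda>x. poly p x ^ j"]) auto
  show "integrable N (\<lambda>e. (\<Sum>i\<in>I. poly p (e i)) ^ j)"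
    by (rule N.even_moment_sum_le(1)[OF fin indep v int, where k = k])
       (auto simp: E odd_moment even)
  show "N.expectation (\<lambda>e. (\<Sum>i\<in>I. poly p (e i)) ^ (2 * k))
      \<le> (real (card I) * v) ^ k * odd_double_fact k"
    by (rule N.even_moment_sum_le(2)[OF fin indep v int, where k = k])
       (auto simp: E odd_moment even)
qed

lemma prob_sum_square_gt_le:
  assumes I: "I \<subseteq> {..<n}" and t: "0 < t"
  shows "N.prob {e \<in> space N. t < (\<Sum>i\<in>I. poly p (e i))\<^sup>2} \<le> real (card I) * V\<^sup>2 / t"
proof -
  have even: "(\<integral>x. poly p x ^ (2 * j) \<partial>noise \<sigma>) \<le> (V\<^sup>2) ^ j * odd_double_fact j" if "j \<le> 1" for j
    using that var noise.prob_space by (cases j) auto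
  note [measurable] = measurable_sum_poly[OF I]
  have v: "0 \<le> V\<^sup>2" by simp
  have "integrable N (\<lambda>e. (\<Sum>i\<in>I. poly p (e i)) ^ (2 * 1))"
    by (rule even_moment_sum(1)[OF I v, of 1]) (rule even)
  moreover have "N.expectation (\<lambda>e. (\<Sum>i\<in>I. poly p (e i)) ^ (2 * 1))
      \<le> (real (card I) * V\<^sup>2) ^ 1 * odd_double_fact 1"
    by (rule even_moment_sum(2)[OF I v, of 1]) (rule even)
  ultimately have "N.prob {e \<in> space N. t < (\<Sum>i\<in>I. poly p (e i))\<^sup>2}
      \<le> (real (card I) * V\<^sup>2) ^ 1 * odd_double_fact 1 / t ^ 1"
    using t by (intro N.prob_square_gt_le measurable_sum_poly[OF I])
  then show ?thesis by simp
qed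

text \<open>The bound on the moment of order \<open>2 j\<close> of a summand grows like
  \<open>(50 j)^(q j)\<close>, in general faster than for a Gaussian. One factor \<open>j^j\<close>
  is matched by the double factorial; the other \<open>q - 1\<close> are frozen at
  \<open>k^(q-1)\<close> and put into the variance \<open>v\<close>, which therefore dominates only
  orders up to \<open>2 k\<close>. At order \<open>2 k\<close> the estimate of the double factorial
  by \<open>(2 k)^k\<close> restores the missing factor \<open>k\<close>, and
  \<open>4 * exp 1 <= 12\<close>.\<close>

lemma prob_sum_square_gt_le_moment:
  assumes I: "I \<subseteq> {..<n}" and t: "0 < t" and k: "1 \<le> k" and q: "q \<noteq> 0"
  shows "N.prob {e \<in> space N. t < (\<Sum>i\<in>I. poly p (e i))\<^sup>2}
    \<le> (12 * real (card I) * V\<^sup>2 * (50 * real k) ^ q / t) ^ k"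
proof -
  obtain l where "q = Suc l" using q not0_implies_Suc by blast
  then have pow_q: "x ^ q = x ^ l * x" for x :: real by simp
  define v where "v = 2 * exp 1 * V\<^sup>2 * 50 ^ q * real k ^ l"
  have v: "0 \<le> v" by (simp add: v_def)
  have even: "(\<integral>x. poly p x ^ (2 * j) \<partial>noise \<sigma>) \<le> v ^ j * odd_double_fact j" if j: "j \<le> k" for j
  proof (cases "j = 0")
    case True
    then show ?thesis using noise.prob_space by simp
  next
    case False
    have "(\<integral>x. poly p x ^ (2 * j) \<partial>noise \<sigma>) \<le> 2 * (V\<^sup>2 * (50 * real j) ^ q) ^ j"
      using False by (intro poly_moment_noise[OF \<sigma> deg _ var]) simp
    also have "(50 * real j) ^ q = 50 ^ q * real j ^ l * real j"
      by (simp add: power_mult_distrib pow_q[of "real j"])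
    also have "2 * (V\<^sup>2 * (50 ^ q * real j ^ l * real j)) ^ j
        = 2 * (V\<^sup>2 * 50 ^ q * real j ^ l) ^ j * real j ^ j"
      by (simp add: power_mult_distrib)
    also have "\<dots> \<le> 2 ^ j * (V\<^sup>2 * 50 ^ q * real k ^ l) ^ j * (exp (real j) * odd_double_fact j)"
    proof (intro mult_mono power_self_le)
      show "2 \<le> (2 ^ j :: real)" using False by (simp add: self_le_power)
      show "(V\<^sup>2 * 50 ^ q * real j ^ l) ^ j \<le> (V\<^sup>2 * 50 ^ q * real k ^ l) ^ j"
        using j by (intro power_mono mult_left_mono) simp_all
    qed simp_all
    also have "\<dots> = v ^ j * odd_double_fact j"
      by (simp add: v_def power_mult_distrib exp_of_nat_mult[symmetric] mult_ac)
    finally show ?thesis .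
  qed
  note [measurable] = measurable_sum_poly[OF I]
  have "N.prob {e \<in> space N. t < (\<Sum>i\<in>I. poly p (e i))\<^sup>2}
      \<le> (real (card I) * v) ^ k * odd_double_fact k / t ^ k"
    using t
  proof (intro N.prob_square_gt_le)
    show "integrable N (\<lambda>e. (\<Sum>i\<in>I. poly p (e i)) ^ (2 * k))"
      by (rule even_moment_sum(1)[OF I v, of k]) (rule even)
    show "N.expectation (\<lambda>e. (\<Sum>i\<in>I. poly p (e i)) ^ (2 * k)) \<le> (real (card I) * v) ^ k * odd_double_fact k"
      by (rule even_moment_sum(2)[OF I v, of k]) (rule even)
  qed (rule measurable_sum_poly[OF I])
  also have "\<dots> \<le> (real (card I) * v) ^ k * (2 * real k) ^ k / t ^ k"
    using t v by (intro divide_right_mono mult_left_mono odd_double_fact_le) auto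
  also have "\<dots> = (real (card I) * v * (2 * real k) / t) ^ k"
    by (simp add: power_mult_distrib power_divide)
  also have "real (card I) * v * (2 * real k) = 4 * exp 1 * real (card I) * V\<^sup>2 * (50 * real k) ^ q"
    by (simp add: v_def power_mult_distrib pow_q[of "real k"])
  also have "(\<dots> / t) ^ k \<le> (12 * real (card I) * V\<^sup>2 * (50 * real k) ^ q / t) ^ k"
    using t exp_le by (intro power_mono divide_right_mono mult_right_mono) auto
  finally show ?thesis .
qed

text \<open>
  For large \<open>L\<close> the moment of order about \<open>L / 25\<close> is used; its base is at most \<open>exp (- 400)\<close>,
  whatever the degree. For bounded \<open>L\<close> Chebyshev's inequality is enough, since the threshold
  carries the huge factor \<open>exp 400\<close>.
\<close>

lemma prob_sum_gt_le_exp: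
  assumes I: "I \<subseteq> {..<n}" "I \<noteq> {}" and L: "1 \<le> L"
  shows "N.prob {e \<in> space N. 16 * exp 400 * (real (card I) * V\<^sup>2 * L ^ q) < (\<Sum>i\<in>I. poly p (e i))\<^sup>2}
    \<le> exp (- 4 * L)"
proof (cases "V = 0 \<or> q = 0")
  case True
  then have zero: "poly p x = 0" for x by (rule poly_eq_0)
  have "0 \<le> 16 * exp 400 * (real (card I) * V\<^sup>2 * L ^ q)" using L by simp
  then have "{e \<in> space N. 16 * exp 400 * (real (card I) * V\<^sup>2 * L ^ q) < (\<Sum>i\<in>I. poly p (e i))\<^sup>2} = {}"
    unfolding zero by (simp only: sum.neutral_const zero_power2 not_less[symmetric]) simp
  then show ?thesis by (simp only: measure_empty exp_ge_zero)
next
  case False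
  define m where "m = real (card I)"
  have m: "0 < m" using I finite_subset[OF I(1)] by (simp add: m_def card_gt_0_iff)
  define t where "t = 16 * exp 400 * (m * V\<^sup>2 * L ^ q)"
  have t: "0 < t" using False m L by (simp add: t_def)
  have "N.prob {e \<in> space N. t < (\<Sum>i\<in>I. poly p (e i))\<^sup>2} \<le> exp (- 4 * L)"
  proof (cases "50 \<le> L")
    case True
    \<comment> \<open>The inequality \<open>50 * k <= L\<close> lets \<open>(50 * k) ^ q\<close>
      cancel against \<open>L ^ q\<close> for every \<open>q\<close>, and
      \<open>L <= 100 * k\<close> turns \<open>exp (- 400 * k)\<close> into
      \<open>exp (- 4 * L)\<close>.\<close>
    define k where "k = nat \<lfloor>L / 50\<rfloor>"
    have k: "1 \<le> k" "50 * real k \<le> L" "L \<le> 100 * real k"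
    proof -
      show "1 \<le> k" using True by (simp add: k_def le_nat_iff le_floor_iff)
      have "real k = of_int \<lfloor>L / 50\<rfloor>" using True by (simp add: k_def)
      then have "real k \<le> L / 50" "L / 50 < real k + 1" by linarith+
      then show "50 * real k \<le> L" "L \<le> 100 * real k" using \<open>1 \<le> k\<close> by linarith+
    qed
    have "N.prob {e \<in> space N. t < (\<Sum>i\<in>I. poly p (e i))\<^sup>2}
        \<le> (12 * m * V\<^sup>2 * (50 * real k) ^ q / t) ^ k"
      unfolding m_def using False k by (intro prob_sum_square_gt_le_moment[OF I(1) t]) auto
    also have "\<dots> \<le> exp (- 400) ^ k"
    proof (rule power_mono)
      have "12 * m * V\<^sup>2 * (50 * real k) ^ q \<le> 16 * m * V\<^sup>2 * L ^ q"
      proof -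
        have "m * V\<^sup>2 * (50 * real k) ^ q \<le> m * V\<^sup>2 * L ^ q"
          using m k by (intro mult_left_mono power_mono) simp_all
        moreover have "0 \<le> m * V\<^sup>2 * L ^ q" using m L by simp
        ultimately have "12 * (m * V\<^sup>2 * (50 * real k) ^ q) \<le> 16 * (m * V\<^sup>2 * L ^ q)"
          by linarith
        then show ?thesis by (simp only: mult.assoc)
      qed
      then have "12 * m * V\<^sup>2 * (50 * real k) ^ q / t \<le> 16 * m * V\<^sup>2 * L ^ q / t"
        using t by (intro divide_right_mono) auto
      also have "\<dots> = exp (- 400)"
        using False m L by (simp add: t_def exp_minus field_simps)
      finally show "12 * m * V\<^sup>2 * (50 * real k) ^ q / t \<le> exp (- 400)" .
    qed (use m t in simp)
    also have "\<dots> = exp (- (400 * real k))"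
      by (simp add: exp_of_nat_mult[symmetric] mult.commute)
    also have "\<dots> \<le> exp (- 4 * L)" using k by simp
    finally show ?thesis .
  next
    case False': False
    have "N.prob {e \<in> space N. t < (\<Sum>i\<in>I. poly p (e i))\<^sup>2} \<le> m * V\<^sup>2 / t"
      unfolding m_def by (rule prob_sum_square_gt_le[OF I(1) t])
    also have "\<dots> = 1 / (16 * exp 400 * L ^ q)"
      using False m by (simp add: t_def)
    also have "\<dots> \<le> 1 / (1 * exp 400 * 1)"
      using L by (intro divide_left_mono mult_mono) (auto simp: one_le_power)
    also have "\<dots> = exp (- 400)" by (simp add: exp_minus inverse_eq_divide)
    also have "\<dots> \<le> exp (- 4 * L)" using False' by simp
    finally show ?thesis .
  qed
  then show ?thesis by (simp add: t_def m_def)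
qed

text \<open>Intended for \<open>L < 1\<close>, where \<open>L ^ q\<close> may be tiny, so the
  threshold does not contain it. The probability 1/100 fits the budget of that case.\<close>

lemma prob_sum_gt_le_chebyshev:
  assumes I: "I \<subseteq> {..<n}" "I \<noteq> {}"
  shows "N.prob {e \<in> space N. 100 * (real (card I) * V\<^sup>2) < (\<Sum>i\<in>I. poly p (e i))\<^sup>2} \<le> 1 / 100"
proof (cases "V = 0")
  case True
  then have "poly p x = 0" for x by (intro poly_eq_0) simp
  then show ?thesis by (simp add: True)
next
  case False
  have m: "0 < real (card I)" using I finite_subset[OF I(1)] by (simp add: card_gt_0_iff)
  show ?thesis
    using prob_sum_square_gt_le[OF I(1), of "100 * (real (card I) * V\<^sup>2)"] m False by simp
qed

text \<open>The sum and its negative have the same law, and the events that they are positive are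
  disjoint.\<close>

lemma prob_sum_pos_le:
  assumes I: "I \<subseteq> {..<n}"
  shows "N.prob {e \<in> space N. 0 < (\<Sum>i\<in>I. poly p (e i))} \<le> 1 / 2"
proof -
  note [measurable] = measurable_sum_poly[OF I]
  \<comment> \<open>\<open>D f\<close> is the joint law of \<open>f\<close> applied to each of the
    \<open>n\<close> noises. Symmetry is a property of the law of \<open>poly p\<close>, while
    \<open>poly p\<close> need not be an odd function; hence the sign is flipped on the product of
    these laws.\<close>
  define D where "D = (\<lambda>f. distr N (Pi\<^sub>M {..<n} (\<lambda>_. noise \<sigma>)) (compose {..<n} f))"
  have D: "D f = Pi\<^sub>M {..<n} (\<lambda>_. distr (noise \<sigma>) (noise \<sigma>) f)" if "f \<in> borel_measurable borel" for f
    unfolding D_def using that prob_space_noise[OF \<sigma>]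
    by (intro distr_PiM_finite_prob_space') (auto cong: measurable_cong_sets)
  have "distr (noise \<sigma>) (noise \<sigma>) (\<lambda>x. - poly p x) = distr (noise \<sigma>) (noise \<sigma>) (poly p)"
    using sym by (simp cong: distr_cong)
  then have eq: "D (\<lambda>x. - poly p x) = D (poly p)"
    by (simp add: D)
  have prob_D: "measure (D f) {y \<in> space N. 0 < (\<Sum>i\<in>I. y i)}
      = N.prob {e \<in> space N. 0 < (\<Sum>i\<in>I. f (e i))}" if [measurable]: "f \<in> borel_measurable borel" for f
  proof -
    have meas: "compose {..<n} f \<in> N \<rightarrow>\<^sub>M N"
      unfolding compose_def by measurable
    have [measurable]: "(\<lambda>y. sum y I) \<in> borel_measurable N"
      using I by (intro borel_measurable_sum measurable_coordinate) auto
    have "(\<Sum>i\<in>I. compose {..<n} f e i) = (\<Sum>i\<in>I. f (e i))" for e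
      using I by (intro sum.cong) (auto simp: compose_def)
    then have "compose {..<n} f -` {y \<in> space N. 0 < (\<Sum>i\<in>I. y i)} \<inter> space N
        = {e \<in> space N. 0 < (\<Sum>i\<in>I. f (e i))}"
      using measurable_space[OF meas] by auto
    then show ?thesis
      unfolding D_def by (subst measure_distr[OF meas]) auto
  qed
  have "N.prob {e \<in> space N. 0 < (\<Sum>i\<in>I. poly p (e i))}
      = N.prob {e \<in> space N. 0 < (\<Sum>i\<in>I. - poly p (e i))}"
    using prob_D[of "poly p"] prob_D[of "\<lambda>x. - poly p x"] eq by simp
  moreover have "N.prob {e \<in> space N. 0 < (\<Sum>i\<in>I. poly p (e i))}
      + N.prob {e \<in> space N. 0 < (\<Sum>i\<in>I. - poly p (e i))} \<le> 1"
  proof -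
    have "N.prob {e \<in> space N. 0 < (\<Sum>i\<in>I. poly p (e i))}
        + N.prob {e \<in> space N. 0 < (\<Sum>i\<in>I. - poly p (e i))}
      = N.prob ({e \<in> space N. 0 < (\<Sum>i\<in>I. poly p (e i))} \<union> {e \<in> space N. 0 < (\<Sum>i\<in>I. - poly p (e i))})"
      by (intro N.finite_measure_Union[symmetric]) (auto simp: sum_negf)
    then show ?thesis by simp
  qed
  ultimately show ?thesis by simp
qed

end

section \<open>Sampling\<close>

text \<open>Pairs and noise can be sampled separately, so that one may condition on all pairs.\<close>

lemma distr_zip_PiM:
  assumes I: "finite I" and "prob_space M" "prob_space L"
  shows "distr (Pi\<^sub>M I (\<lambda>_. M) \<Otimes>\<^sub>M Pi\<^sub>M I (\<lambda>_. L)) (Pi\<^sub>M I (\<lambda>_. M \<Otimes>\<^sub>M L))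
      (\<lambda>(x, e). \<lambda>i\<in>I. (x i, e i)) = Pi\<^sub>M I (\<lambda>_. M \<Otimes>\<^sub>M L)"
    (is "distr ?P ?Q ?z = _")
proof -
  interpret M: prob_space M by fact
  interpret L: prob_space L by fact
  interpret pair: pair_prob_space M L ..
  interpret PM: product_prob_space "\<lambda>_. M" I ..
  interpret PL: product_prob_space "\<lambda>_. L" I ..
  interpret PP: product_prob_space "\<lambda>_. M \<Otimes>\<^sub>M L" I ..
  have z [measurable]: "?z \<in> ?P \<rightarrow>\<^sub>M ?Q" by measurable
  show ?thesis
  proof (rule PP.PiM_eqI[OF I])
    fix A assume A [measurable]: "\<And>i. i \<in> I \<Longrightarrow> A i \<in> sets (M \<Otimes>\<^sub>M L)"
    have box [measurable]: "Pi\<^sub>E I A \<in> sets ?Q"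
      using I A by (intro sets_PiM_I_finite) auto
    \<comment> \<open>For fixed pairs the preimage of a box is a box in the noises, so the inner
      measure factors; the outer integral then factors because the pairs are independent.\<close>
    have slice: "Pair x -` (?z -` Pi\<^sub>E I A \<inter> space ?P) = (\<Pi>\<^sub>E i\<in>I. Pair (x i) -` A i)"
      if x: "x \<in> space (Pi\<^sub>M I (\<lambda>_. M))" for x
    proof -
      have "y \<in> space L" if "i \<in> I" "(x i, y) \<in> A i" for i y
        using sets.sets_into_space[OF A[OF that(1)]] that(2) by (auto simp: space_pair_measure)
      then show ?thesis
        using x by (auto simp: space_pair_measure space_PiM PiE_iff extensional_def)
    qed
    have "emeasure (distr ?P ?Q ?z) (Pi\<^sub>E I A) = emeasure ?P (?z -` Pi\<^sub>E I A \<inter> space ?P)"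
      by (rule emeasure_distr) measurable
    also have "\<dots> = (\<integral>\<^sup>+ x. emeasure (Pi\<^sub>M I (\<lambda>_. L)) (\<Pi>\<^sub>E i\<in>I. Pair (x i) -` A i) \<partial>Pi\<^sub>M I (\<lambda>_. M))"
      unfolding PL.P.emeasure_pair_measure_alt[OF measurable_sets[OF z box]]
      by (intro nn_integral_cong arg_cong[where f = "emeasure _"] slice)
    also have "\<dots> = (\<integral>\<^sup>+ x. (\<Prod>i\<in>I. emeasure L (Pair (x i) -` A i)) \<partial>Pi\<^sub>M I (\<lambda>_. M))"
      using I A by (intro nn_integral_cong PL.emeasure_PiM sets_Pair1[where ?M1.0 = M]) auto
    also have "\<dots> = (\<Prod>i\<in>I. \<integral>\<^sup>+ x. emeasure L (Pair x -` A i) \<partial>M)"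
      using I A by (intro PM.product_nn_integral_prod L.measurable_emeasure_Pair) auto
    also have "\<dots> = (\<Prod>i\<in>I. emeasure (M \<Otimes>\<^sub>M L) (A i))"
      using A by (intro prod.cong refl L.emeasure_pair_measure_alt[symmetric]) auto
    finally show "emeasure (distr ?P ?Q ?z) (Pi\<^sub>E I A) = (\<Prod>i\<in>I. emeasure (M \<Otimes>\<^sub>M L) (A i))" .
  qed simp
qed

lemma sampling_space_eq_distr:
  assumes "0 < \<sigma>"
  shows "sampling_space n d \<sigma> =
    distr (Pi\<^sub>M {..<n} (\<lambda>_. measure_pmf d) \<Otimes>\<^sub>M Pi\<^sub>M {..<n} (\<lambda>_. noise \<sigma>)) (sampling_space n d \<sigma>)
      (\<lambda>(x, e). \<lambda>i\<in>{..<n}. (x i, e i))"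
  unfolding sampling_space_def
  by (rule distr_zip_PiM[symmetric]) (auto intro: prob_space_noise[OF assms] prob_space_measure_pmf)

lemma prob_space_sampling_space: "0 < \<sigma> \<Longrightarrow> prob_space (sampling_space n d \<sigma>)"
  unfolding sampling_space_def
  by (intro prob_space_PiM prob_space_pair prob_space_measure_pmf prob_space_noise)

text \<open>Fubini in place of conditional probabilities: a bound uniform in the fixed pairs
  \<open>x\<close> survives integration over them. With \<open>x\<close> fixed, the random set of
  visits to a pair becomes deterministic.\<close>

lemma measure_sampling_space_le:
  assumes \<sigma>: "0 < \<sigma>" and E: "{\<omega> \<in> space (sampling_space n d \<sigma>). P \<omega>} \<in> sets (sampling_space n d \<sigma>)"
    and le: "\<And>x. measure (Pi\<^sub>M {..<n} (\<lambda>_. noise \<sigma>))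
      {e \<in> space (Pi\<^sub>M {..<n} (\<lambda>_. noise \<sigma>)). P (\<lambda>i\<in>{..<n}. (x i, e i))} \<le> B"
  shows "measure (sampling_space n d \<sigma>) {\<omega> \<in> space (sampling_space n d \<sigma>). P \<omega>} \<le> B"
proof -
  let ?D = "Pi\<^sub>M {..<n} (\<lambda>_. measure_pmf d)" and ?N = "Pi\<^sub>M {..<n} (\<lambda>_. noise \<sigma>)"
  let ?S = "sampling_space n d \<sigma>" and ?z = "\<lambda>(x, e). \<lambda>i\<in>{..<n}. (x i, e i)"
  let ?E = "{\<omega> \<in> space ?S. P \<omega>}"
  interpret N: prob_space ?N by (rule prob_space_PiM_noise[OF \<sigma>])
  interpret D: prob_space ?D by (intro prob_space_PiM prob_space_measure_pmf)
  interpret S: prob_space ?S by (rule prob_space_sampling_space[OF \<sigma>])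
  have B: "0 \<le> B" using le measure_nonneg order_trans by blast
  have z: "?z \<in> ?D \<Otimes>\<^sub>M ?N \<rightarrow>\<^sub>M ?S"
    unfolding sampling_space_def by measurable
  have slice: "Pair x -` (?z -` ?E \<inter> space (?D \<Otimes>\<^sub>M ?N)) = {e \<in> space ?N. P (\<lambda>i\<in>{..<n}. (x i, e i))}"
    if "x \<in> space ?D" for x
    using measurable_space[OF z] that by (auto simp: space_pair_measure)
  have "emeasure ?S ?E = emeasure (?D \<Otimes>\<^sub>M ?N) (?z -` ?E \<inter> space (?D \<Otimes>\<^sub>M ?N))"
    by (subst sampling_space_eq_distr[OF \<sigma>]) (rule emeasure_distr[OF z E])
  also have "\<dots> = (\<integral>\<^sup>+ x. emeasure ?N {e \<in> space ?N. P (\<lambda>i\<in>{..<n}. (x i, e i))} \<partial>?D)"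
    unfolding N.emeasure_pair_measure_alt[OF measurable_sets[OF z E]]
    by (intro nn_integral_cong arg_cong[where f = "emeasure _"] slice)
  also have "\<dots> \<le> (\<integral>\<^sup>+ x. ennreal B \<partial>?D)"
    using le by (intro nn_integral_mono) (simp add: N.emeasure_eq_measure ennreal_leI)
  also have "\<dots> = ennreal B" by (simp add: D.emeasure_space_1)
  finally show ?thesis using B by (simp add: S.emeasure_eq_measure)
qed

text \<open>Chernoff's bound, applied to the expectation of \<open>2 powr - N\<close> for the number of visits \<open>N\<close>.\<close>

lemma measure_few_visits_le:
  assumes \<sigma>: "0 < \<sigma>" and n: "0 < n"
  shows "measure (sampling_space n d \<sigma>) {\<omega> \<in> space (sampling_space n d \<sigma>).
      real (card {i. i < n \<and> fst (\<omega> i) = z}) < real n * pmf d z / 2}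
    \<le> exp (- real n * pmf d z / 8)"
proof -
  let ?S = "sampling_space n d \<sigma>"
  interpret S: prob_space ?S by (rule prob_space_sampling_space[OF \<sigma>])
  interpret D: prob_space "measure_pmf d \<Otimes>\<^sub>M noise \<sigma>"
    by (intro prob_space_pair prob_space_measure_pmf prob_space_noise[OF \<sigma>])
  interpret P: product_prob_space "\<lambda>_. measure_pmf d \<Otimes>\<^sub>M noise \<sigma>" "{..<n}" ..
  interpret noise: prob_space "noise \<sigma>" by (rule prob_space_noise[OF \<sigma>])
  define a where "a = real n * pmf d z"
  \<comment> \<open>The product of these factors over the sample is \<open>2 powr - N\<close>, and
    each has expectation \<open>1 - pmf d z / 2\<close>.\<close>
  define g where "g = (\<lambda>y :: (nat \<times> nat) \<times> real. if fst y = z then 1 / 2 else 1 :: real)"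
  have g_meas [measurable]: "g \<in> borel_measurable (measure_pmf d \<Otimes>\<^sub>M noise \<sigma>)"
    unfolding g_def by measurable
  have g_range: "0 \<le> g y" "g y \<le> 1" for y by (auto simp: g_def)
  have "(\<integral>\<^sup>+ y. g y \<partial>(measure_pmf d \<Otimes>\<^sub>M noise \<sigma>)) = (\<integral>\<^sup>+ x. (if x = z then 1 / 2 else 1 :: real) \<partial>measure_pmf d)"
    by (subst noise.nn_integral_fst[symmetric]) (auto simp: g_def noise.emeasure_space_1[unfolded space_noise])
  also have "\<dots> = ennreal (\<integral>x. (if x = z then 1 / 2 else 1 :: real) \<partial>measure_pmf d)"
    by (intro nn_integral_eq_integral measure_pmf.integrable_const_bound[where B = 1]) auto
  also have "(\<integral>x. (if x = z then 1 / 2 else 1 :: real) \<partial>measure_pmf d) = (\<integral>x. 1 - indicator {z} x / 2 \<partial>measure_pmf d)"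
    by (intro Bochner_Integration.integral_cong) (auto split: split_indicator)
  also have "\<dots> = 1 - pmf d z / 2"
  proof -
    have "integrable (measure_pmf d) (\<lambda>x. indicator {z} x / 2 :: real)"
      by (intro measure_pmf.integrable_const_bound[where B = 1]) (auto split: split_indicator)
    then show ?thesis by (simp add: pmf.rep_eq)
  qed
  finally have g_int: "(\<integral>\<^sup>+ y. g y \<partial>(measure_pmf d \<Otimes>\<^sub>M noise \<sigma>)) = ennreal (1 - pmf d z / 2)" .
  have prod_g: "(\<Prod>i<n. g (\<omega> i)) = (1 / 2) ^ card {i. i < n \<and> fst (\<omega> i) = z}" for \<omega>
  proof -
    have "(\<Prod>i<n. g (\<omega> i)) = (\<Prod>i\<in>{i \<in> {..<n}. fst (\<omega> i) = z}. 1 / 2)"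
      unfolding g_def by (rule prod.inter_filter[symmetric]) simp
    then show ?thesis by simp
  qed
  have "(\<integral>\<^sup>+ \<omega>. (\<Prod>i<n. g (\<omega> i)) \<partial>?S) = (\<integral>\<^sup>+ \<omega>. (\<Prod>i<n. ennreal (g (\<omega> i))) \<partial>?S)"
    by (simp add: prod_ennreal g_range)
  also have "\<dots> = (\<Prod>i<n. \<integral>\<^sup>+ y. g y \<partial>(measure_pmf d \<Otimes>\<^sub>M noise \<sigma>))"
    unfolding sampling_space_def by (rule P.product_nn_integral_prod) auto
  also have "\<dots> = ennreal ((1 - pmf d z / 2) ^ n)"
    unfolding g_int using pmf_le_1[of d z] by (simp add: ennreal_power)
  also have "\<dots> \<le> ennreal (exp (- a / 2))"
  proof (rule ennreal_leI)
    have "(1 - pmf d z / 2) ^ n \<le> exp (- pmf d z / 2) ^ n"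
      using pmf_le_1[of d z] exp_ge_add_one_self[of "- pmf d z / 2"] by (intro power_mono) auto
    also have "\<dots> = exp (- a / 2)" by (simp add: a_def exp_of_nat_mult[symmetric])
    finally show "(1 - pmf d z / 2) ^ n \<le> exp (- a / 2)" .
  qed
  finally have E: "(\<integral>\<^sup>+ \<omega>. (\<Prod>i<n. g (\<omega> i)) \<partial>?S) \<le> ennreal (exp (- a / 2))" .
  have meas [measurable]: "(\<lambda>\<omega>. \<Prod>i<n. g (\<omega> i)) \<in> borel_measurable ?S"
    unfolding sampling_space_def by measurable
  have sub: "(1 / 2) powr (a / 2) \<le> (\<Prod>i<n. g (\<omega> i))"
    if "real (card {i. i < n \<and> fst (\<omega> i) = z}) < real n * pmf d z / 2" for \<omega>
    unfolding prod_g using that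
    by (subst powr_realpow[symmetric]) (auto simp: a_def intro!: powr_mono')
  have "emeasure ?S {\<omega> \<in> space ?S. real (card {i. i < n \<and> fst (\<omega> i) = z}) < real n * pmf d z / 2}
      \<le> emeasure ?S {\<omega> \<in> space ?S. 1 \<le> ennreal (2 powr (a / 2)) * ennreal (\<Prod>i<n. g (\<omega> i))}"
  proof (rule emeasure_mono)
    have "1 \<le> ennreal (2 powr (a / 2)) * ennreal (\<Prod>i<n. g (\<omega> i))"
      if "real (card {i. i < n \<and> fst (\<omega> i) = z}) < real n * pmf d z / 2" for \<omega>
    proof -
      have "1 = 2 powr (a / 2) * (1 / 2) powr (a / 2)"
        by (simp add: powr_mult[symmetric])
      also have "\<dots> \<le> 2 powr (a / 2) * (\<Prod>i<n. g (\<omega> i))"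
        using sub[OF that] by (intro mult_left_mono) auto
      finally show ?thesis
        by (simp add: ennreal_mult'[symmetric])
    qed
    then show "{\<omega> \<in> space ?S. real (card {i. i < n \<and> fst (\<omega> i) = z}) < real n * pmf d z / 2}
        \<subseteq> {\<omega> \<in> space ?S. 1 \<le> ennreal (2 powr (a / 2)) * ennreal (\<Prod>i<n. g (\<omega> i))}" by auto
  qed measurable
  also have "\<dots> \<le> ennreal (2 powr (a / 2)) * (\<integral>\<^sup>+ \<omega>. ennreal (\<Prod>i<n. g (\<omega> i)) * indicator (space ?S) \<omega> \<partial>?S)"
    by (rule nn_integral_Markov_inequality) measurable
  also have "\<dots> \<le> ennreal (2 powr (a / 2)) * ennreal (exp (- a / 2))"
    using E by (intro mult_left_mono) (auto cong: nn_integral_cong)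
  also have "\<dots> = ennreal (exp (a / 2 * ln 2 - a / 2))"
    by (simp add: ennreal_mult'[symmetric] powr_def exp_add[symmetric])
  also have "\<dots> \<le> ennreal (exp (- a / 8))"
  proof (intro ennreal_leI, simp only: exp_le_cancel_iff)
    \<comment> \<open>The exponent \<open>a / 2 * (ln 2 - 1)\<close> is at most
      \<open>- a / 8\<close> as soon as \<open>ln 2 <= 3 / 4\<close>.\<close>
    have "a * ln 2 \<le> a * (25 / 36)"
      using ln2_le_25_over_36 by (intro mult_left_mono) (auto simp: a_def)
    moreover have "0 \<le> a" by (simp add: a_def)
    ultimately show "a / 2 * ln 2 - a / 2 \<le> - a / 8" by simp
  qed
  finally show ?thesis by (simp add: S.emeasure_eq_measure a_def)
qed

section \<open>Suboptimality of the pessimistic policy\<close>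

lemma rating_modelD:
  assumes "rating_model q R \<sigma> h C1 C2"
  shows "0 < \<sigma>" and "0 < C1" and "mean_rating h \<sigma> ` {0..R} \<subseteq> {0..R}"
    and "strict_mono_on {0..R} (mean_rating h \<sigma>)" and "mean_rating h \<sigma> 0 = 0"
    and "\<forall>x\<in>{0..R}. \<exists>p :: real poly. degree p = q \<and> (\<forall>\<epsilon>. h x \<epsilon> = poly p \<epsilon>)"
    and "\<forall>x\<in>{0..R}. distr (noise \<sigma>) borel (\<lambda>\<epsilon>. - (h x \<epsilon> - mean_rating h \<sigma> x)) =
        distr (noise \<sigma>) borel (\<lambda>\<epsilon>. h x \<epsilon> - mean_rating h \<sigma> x)"
    and "\<forall>x\<in>{0..R}. \<forall>y\<in>{0..R}. y \<le> x \<longrightarrow>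
        mean_rating_inv R h \<sigma> x - mean_rating_inv R h \<sigma> y \<le> C1 * mean_rating_inv R h \<sigma> (x - y)"
  by (insert assms[unfolded rating_model_def], (elim conjE, assumption)+)

lemma mean_rating_inv_nonneg:
  assumes "0 \<le> R" "mean_rating h \<sigma> 0 = 0" "0 \<le> y"
  shows "0 \<le> mean_rating_inv R h \<sigma> y"
  unfolding mean_rating_inv_def using assms
  by (intro cSup_upper bdd_aboveI[of _ R]) auto

lemma mean_rating_inv_mono:
  assumes "0 \<le> R" "mean_rating h \<sigma> 0 = 0" "0 \<le> y" "y \<le> z"
  shows "mean_rating_inv R h \<sigma> y \<le> mean_rating_inv R h \<sigma> z"
  unfolding mean_rating_inv_def using assms
  by (intro cSup_subset_mono bdd_aboveI[of _ R]) auto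

text \<open>Telescoping: each further step of length \<open>y\<close> costs \<open>C1\<close> times
  the inverse at \<open>y\<close>. The regularity condition covers arguments in \<open>[0,R]\<close>
  only, so they are clipped at \<open>R\<close>. The generalized inverse does not notice, since the
  mean rating at \<open>R\<close> is at most \<open>R\<close> and the inverse is saturated from
  there on.\<close>

lemma mean_rating_inv_mult_le:
  assumes model: "rating_model q R \<sigma> h C1 C2" and R: "0 \<le> R" and y: "0 \<le> y"
  shows "mean_rating_inv R h \<sigma> (real N * y) \<le> real N * C1 * mean_rating_inv R h \<sigma> y"
proof -
  let ?inv = "mean_rating_inv R h \<sigma>"
  note C1 = rating_modelD(2)[OF model] and into = rating_modelD(3)[OF model]
    and incr = rating_modelD(4)[OF model] and mean_0 = rating_modelD(5)[OF model]
    and sub = rating_modelD(8)[OF model, rule_format]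
  have "mean_rating h \<sigma> R \<le> R" using into R by (auto simp: image_subset_iff)
  then have clip: "?inv (min z R) = ?inv z" if "0 \<le> z" for z
    using that R by (cases "z \<le> R") (auto simp: min_def mean_rating_inv_saturated[OF incr])
  show ?thesis
  proof (induction N)
    case 0
    have "?inv 0 = 0"
      using mean_rating_inv_mean_rating[OF incr, of 0] R mean_0 by simp
    then show ?case by simp
  next
    case (Suc N)
    let ?u = "min (real (Suc N) * y) R" and ?w = "min (real N * y) R"
    have range: "?u \<in> {0..R}" "?w \<in> {0..R}" "?w \<le> ?u" "?u - ?w \<le> y"
      using R y by (auto simp: min_def algebra_simps)
    have "?inv ?u - ?inv ?w \<le> C1 * ?inv (?u - ?w)"
      using range by (intro sub)
    also have "\<dots> \<le> C1 * ?inv y"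
      using range C1 by (intro mult_left_mono mean_rating_inv_mono[OF R mean_0]) auto
    finally have "?inv (real (Suc N) * y) \<le> ?inv (real N * y) + C1 * ?inv y"
      using y by (simp add: clip del: of_nat_Suc)
    also have "\<dots> \<le> real N * C1 * ?inv y + C1 * ?inv y"
      using Suc by simp
    finally show ?case by (simp add: algebra_simps)
  qed
qed

text \<open>\<open>C1\<close> enters twice: once to turn a difference of inverses into the inverse
  of the gap, once to pull the constant out of the inverse. The latter works for integer multiples,
  hence the ceiling.\<close>

lemma reward_gap_le:
  assumes model: "rating_model q R \<sigma> h C1 C2" and x: "x \<in> {0..R}" and y: "y \<in> {0..R}" and yx: "y \<le> x"
    and gap: "mean_rating h \<sigma> x - mean_rating h \<sigma> y \<le> K * \<epsilon>" and K: "0 \<le> K" and \<epsilon>: "0 \<le> \<epsilon>"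
  shows "x - y \<le> real (nat \<lceil>K\<rceil>) * C1\<^sup>2 * mean_rating_inv R h \<sigma> \<epsilon>"
proof -
  let ?inv = "mean_rating_inv R h \<sigma>"
  note C1 = rating_modelD(2)[OF model] and into = rating_modelD(3)[OF model]
    and incr = rating_modelD(4)[OF model] and mean_0 = rating_modelD(5)[OF model]
    and sub = rating_modelD(8)[OF model, rule_format]
  have R: "0 \<le> R" using x by simp
  have le: "mean_rating h \<sigma> y \<le> mean_rating h \<sigma> x"
    using strict_mono_on_less_eq[OF incr y x] yx by simp
  have K': "K * \<epsilon> \<le> real (nat \<lceil>K\<rceil>) * \<epsilon>"
    using \<epsilon> K by (intro mult_right_mono real_nat_ceiling_ge)
  have "x - y = ?inv (mean_rating h \<sigma> x) - ?inv (mean_rating h \<sigma> y)"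
    using mean_rating_inv_mean_rating[OF incr] x y by simp
  also have "\<dots> \<le> C1 * ?inv (mean_rating h \<sigma> x - mean_rating h \<sigma> y)"
    using subsetD[OF into imageI[OF x]] subsetD[OF into imageI[OF y]] le by (rule sub)
  also have "\<dots> \<le> C1 * ?inv (real (nat \<lceil>K\<rceil>) * \<epsilon>)"
    using C1 le gap K' by (intro mult_left_mono mean_rating_inv_mono[OF R mean_0]) auto
  also have "\<dots> \<le> C1 * (real (nat \<lceil>K\<rceil>) * C1 * ?inv \<epsilon>)"
    using C1 by (intro mult_left_mono mean_rating_inv_mult_le[OF model R \<epsilon>]) auto
  finally show ?thesis by (simp add: power2_eq_square mult_ac)
qed

section \<open>Optimal policies and suboptimality as a sum over pairs\<close>

text \<open>The value of the policy at \<open>s\<close> is at least every single reward and is also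
  their average under the policy. The weighted nonnegative shortfalls thus sum to zero, so actions
  of positive weight attain the maximum.\<close>

lemma optimal_policy_support:
  assumes opt: "is_optimal_policy S A r \<pi>opt" and s: "s \<in> {1..S}"
    and a: "0 < pmf (\<pi>opt s) a" and a': "a' \<in> {1..A}"
  shows "r s a' \<le> r s a"
proof -
  let ?M = "expected_reward r \<pi>opt s"
  have supp: "set_pmf (\<pi>opt s) \<subseteq> {1..A}"
    using opt s by (auto simp: is_optimal_policy_def is_policy_def)
  have le: "r s b \<le> ?M" if "b \<in> {1..A}" for b
  proof -
    have "is_policy S A (\<lambda>_. return_pmf b)" using that by (simp add: is_policy_def)
    then have "expected_reward r (\<lambda>_. return_pmf b) s \<le> ?M"
      using opt s by (simp add: is_optimal_policy_def)
    then show ?thesis by (simp add: expected_reward_def)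
  qed
  have "?M = (\<Sum>b\<in>{1..A}. r s b * pmf (\<pi>opt s) b)"
    unfolding expected_reward_def using supp by (intro integral_measure_pmf_real) auto
  moreover have "(\<Sum>b\<in>{1..A}. pmf (\<pi>opt s) b) = 1"
    using supp by (intro sum_pmf_eq_1) auto
  ultimately have "(\<Sum>b\<in>{1..A}. (?M - r s b) * pmf (\<pi>opt s) b) = 0"
    by (simp add: left_diff_distrib sum_subtractf sum_distrib_left[symmetric])
  moreover have "a \<in> {1..A}" using a supp by (simp add: pmf_positive_iff subset_iff)
  ultimately have "(?M - r s a) * pmf (\<pi>opt s) a = 0"
    using le by (subst (asm) sum_nonneg_eq_0_iff) auto
  then show ?thesis using a le[OF a'] by simp
qed

text \<open>The weights of the optimal policy at a state sum to one, so the reward of the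
  deterministic choice may be averaged with them as well.\<close>

lemma SubOpt_eq_sum:
  assumes "contextual_bandit S A R r \<rho>" and "is_policy S A \<pi>opt"
  shows "SubOpt r \<rho> \<pi>opt (deterministic_policy f)
    = (\<Sum>(s, a)\<in>{1..S} \<times> {1..A}. visitation \<rho> \<pi>opt s a * (r s a - r s (f s)))"
proof -
  have inner: "expected_reward r \<pi>opt s - r s (f s)
      = (\<Sum>a\<in>{1..A}. pmf (\<pi>opt s) a * (r s a - r s (f s)))" if s: "s \<in> {1..S}" for s
  proof -
    have supp: "set_pmf (\<pi>opt s) \<subseteq> {1..A}"
      using assms s by (auto simp: is_policy_def)
    have "expected_reward r \<pi>opt s = (\<Sum>a\<in>{1..A}. r s a * pmf (\<pi>opt s) a)"
      unfolding expected_reward_def using supp by (intro integral_measure_pmf_real) auto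
    moreover have "(\<Sum>a\<in>{1..A}. pmf (\<pi>opt s) a) = 1"
      using supp by (intro sum_pmf_eq_1) auto
    ultimately show ?thesis
      by (simp add: right_diff_distrib sum_subtractf sum_distrib_right[symmetric] mult.commute)
  qed
  have "SubOpt r \<rho> \<pi>opt (deterministic_policy f)
      = (\<Sum>s\<in>{1..S}. (expected_reward r \<pi>opt s - r s (f s)) * pmf \<rho> s)"
    unfolding SubOpt_def expected_reward_def[of r "deterministic_policy f"]
    using assms(1) by (subst integral_measure_pmf_real[of "{1..S}"]) (auto simp: contextual_bandit_def)
  also have "\<dots> = (\<Sum>s\<in>{1..S}. \<Sum>a\<in>{1..A}. visitation \<rho> \<pi>opt s a * (r s a - r s (f s)))"
    by (intro sum.cong refl)
       (simp add: inner visitation_def sum_distrib_left sum_distrib_right mult_ac)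
  finally show ?thesis by (simp add: sum.cartesian_product)
qed

section \<open>Noise attached to a pair in a fixed instance\<close>

text \<open>Fixes one instance, on which the constants of the theorem must not depend:
  \<open>noise_factor\<close> and \<open>gap_factor\<close>, defined inside, involve
  \<open>q\<close> and \<open>C1\<close> only.\<close>

locale lcb_setting =
  fixes q :: nat and C1 C2 :: real and S A :: nat and R :: real and r :: "nat \<Rightarrow> nat \<Rightarrow> real"
    and \<rho> :: "nat pmf" and \<sigma> :: real and h :: "real \<Rightarrow> real \<Rightarrow> real" and V :: real
    and d :: "(nat \<times> nat) pmf" and \<pi>opt :: "nat \<Rightarrow> nat pmf" and \<delta> :: real and n :: nat
  assumes bandit: "contextual_bandit S A R r \<rho>"
    and model: "rating_model q R \<sigma> h C1 C2"
    and var_le: "\<And>x. x \<in> {0..R} \<Longrightarrow> rating_variance h \<sigma> x \<le> V\<^sup>2"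
    and d_range: "set_pmf d \<subseteq> {1..S} \<times> {1..A}"
    and optimal: "is_optimal_policy S A r \<pi>opt"
    and coverage: "\<And>s a. s \<in> {1..S} \<Longrightarrow> a \<in> {1..A} \<Longrightarrow>
      visitation \<rho> \<pi>opt s a > 0 \<Longrightarrow> pmf d (s, a) > 0"
    and \<delta>: "0 < \<delta>" "\<delta> < 1"
    and n_large: "real n > 8 * ln (2 * real (S * A) / \<delta>) / min_sampling_prob S A d"
begin

definition L :: real where "L = ln (real (S * A) / \<delta>)"

definition visits :: "nat \<Rightarrow> nat \<Rightarrow> (nat \<Rightarrow> (nat \<times> nat) \<times> real) \<Rightarrow> nat set" where
  "visits s a \<omega> = {i. i < n \<and> fst (\<omega> i) = (s, a)}"

text \<open>Not divided by the number of visits: it is then a plain sum over an index set, as in the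
  tail bounds, and is zero for an unvisited pair.\<close>

definition total_noise :: "nat \<Rightarrow> nat \<Rightarrow> (nat \<Rightarrow> (nat \<times> nat) \<times> real) \<Rightarrow> real" where
  "total_noise s a \<omega> = (\<Sum>i\<in>visits s a \<omega>. h (r s a) (snd (\<omega> i)) - mean_rating h \<sigma> (r s a))"

text \<open>Refers to rewards and not to \<open>\<pi>opt\<close>, because the learned policy may
  choose a maximiser to which \<open>\<pi>opt\<close> gives no weight.\<close>

definition best_action :: "nat \<Rightarrow> nat \<Rightarrow> bool" where
  "best_action s a \<longleftrightarrow> (\<forall>a'\<in>{1..A}. r s a' \<le> r s a)"

abbreviation \<Omega> where "\<Omega> \<equiv> sampling_space n d \<sigma>"

lemma \<sigma>_pos: "0 < \<sigma>"
  by (rule rating_modelD(1)[OF model])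

sublocale prob_space \<Omega> by (rule prob_space_sampling_space[OF \<sigma>_pos])

lemma reward_range: "s \<in> {1..S} \<Longrightarrow> a \<in> {1..A} \<Longrightarrow> r s a \<in> {0..R}"
  using bandit by (simp add: contextual_bandit_def)

lemma S_A_pos: "1 \<le> S" "1 \<le> A"
  using bandit by (auto simp: contextual_bandit_def)

lemma L_pos: "0 < L"
proof -
  have "1 \<le> S * A" using S_A_pos by simp
  then have "1 \<le> real (S * A)" by (simp only: real_of_nat_ge_one_iff)
  then show ?thesis using \<delta> by (simp add: L_def less_divide_eq)
qed

lemma exp_minus_L: "exp (- L) = \<delta> / real (S * A)"
  using S_A_pos \<delta> by (simp add: L_def exp_minus)

lemma centred_rating:
  assumes "x \<in> {0..R}"
  obtains p where "centred_symmetric_polynomial \<sigma> V p q"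
    and "\<And>\<epsilon>. h x \<epsilon> - mean_rating h \<sigma> x = poly p \<epsilon>"
proof -
  obtain p0 where p0: "degree p0 = q" "\<And>\<epsilon>. h x \<epsilon> = poly p0 \<epsilon>"
    using rating_modelD(6)[OF model] assms by metis
  define p where "p = p0 - [:mean_rating h \<sigma> x:]"
  have p: "h x \<epsilon> - mean_rating h \<sigma> x = poly p \<epsilon>" for \<epsilon>
    by (simp add: p_def p0)
  interpret noise: prob_space "noise \<sigma>" by (rule prob_space_noise[OF \<sigma>_pos])
  have "centred_symmetric_polynomial \<sigma> V p q"
  proof
    show "degree p \<le> q"
      unfolding p_def using p0 by (intro degree_diff_le) auto
    show "(\<integral>x. poly p x \<partial>noise \<sigma>) = 0"
      using noise.prob_space integrable_poly_noise[OF \<sigma>_pos, of p0]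
      by (simp add: p_def mean_rating_def p0)
    show "(\<integral>x. (poly p x)\<^sup>2 \<partial>noise \<sigma>) \<le> V\<^sup>2"
      using var_le[OF assms] by (simp add: rating_variance_def p)
    show "distr (noise \<sigma>) borel (\<lambda>x. - poly p x) = distr (noise \<sigma>) borel (poly p)"
      using bspec[OF rating_modelD(7)[OF model] assms] by (simp only: p)
  qed (rule \<sigma>_pos)
  then show thesis using p by (rule that)
qed

lemma measurable_card_visits [measurable]:
  "(\<lambda>\<omega>. real (card (visits s a \<omega>))) \<in> borel_measurable \<Omega>"
proof -
  have "real (card (visits s a \<omega>)) = (\<Sum>i<n. if fst (\<omega> i) = (s, a) then 1 else 0)" for \<omega>
    by (simp add: visits_def sum.If_cases Int_def)
  then show ?thesis
    unfolding sampling_space_def by simp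
qed

lemma measurable_total_noise:
  assumes "s \<in> {1..S}" "a \<in> {1..A}"
  shows "total_noise s a \<in> borel_measurable \<Omega>"
proof -
  obtain p where p: "\<And>\<epsilon>. h (r s a) \<epsilon> - mean_rating h \<sigma> (r s a) = poly p \<epsilon>"
    using centred_rating[OF reward_range[OF assms]] by metis
  have [measurable]: "(\<lambda>x. poly p x) \<in> noise \<sigma> \<rightarrow>\<^sub>M borel"
    by (simp cong: measurable_cong_sets)
  have "total_noise s a = (\<lambda>\<omega>. \<Sum>i<n. if fst (\<omega> i) = (s, a) then poly p (snd (\<omega> i)) else 0)"
    by (rule ext) (simp add: total_noise_def visits_def p sum.If_cases Int_def)
  then show ?thesis
    unfolding sampling_space_def by simp
qed

text \<open>Transfers tail bounds from a fixed index set to the random set of visits. The function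
  \<open>\<phi>\<close> is the square for two-sided bounds and the identity for the one-sided
  bound.\<close>

lemma noise_event_le:
  assumes sa: "s \<in> {1..S}" "a \<in> {1..A}" and \<phi> [measurable]: "\<phi> \<in> borel_measurable borel"
    and B: "0 \<le> B"
    and le: "\<And>p I. centred_symmetric_polynomial \<sigma> V p q \<Longrightarrow> I \<subseteq> {..<n} \<Longrightarrow> I \<noteq> {} \<Longrightarrow>
      measure (Pi\<^sub>M {..<n} (\<lambda>_. noise \<sigma>)) {e \<in> space (Pi\<^sub>M {..<n} (\<lambda>_. noise \<sigma>)).
        t * real (card I) < \<phi> (\<Sum>i\<in>I. poly p (e i))} \<le> B"
  shows "{\<omega> \<in> space \<Omega>. visits s a \<omega> \<noteq> {} \<and> t * real (card (visits s a \<omega>)) < \<phi> (total_noise s a \<omega>)} \<in> events"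
    and "prob {\<omega> \<in> space \<Omega>. visits s a \<omega> \<noteq> {} \<and> t * real (card (visits s a \<omega>)) < \<phi> (total_noise s a \<omega>)} \<le> B"
proof -
  note [measurable] = measurable_total_noise[OF sa]
  have fin: "finite (visits s a \<omega>)" for \<omega> by (simp add: visits_def)
  have "{\<omega> \<in> space \<Omega>. real (card (visits s a \<omega>)) \<noteq> 0 \<and> t * real (card (visits s a \<omega>)) < \<phi> (total_noise s a \<omega>)} \<in> events"
    by measurable
  then show events: "{\<omega> \<in> space \<Omega>. visits s a \<omega> \<noteq> {} \<and> t * real (card (visits s a \<omega>)) < \<phi> (total_noise s a \<omega>)} \<in> events"
    using fin by simp
  obtain p where p: "centred_symmetric_polynomial \<sigma> V p q"
    "\<And>\<epsilon>. h (r s a) \<epsilon> - mean_rating h \<sigma> (r s a) = poly p \<epsilon>"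
    using centred_rating[OF reward_range[OF sa]] by metis
  show "prob {\<omega> \<in> space \<Omega>. visits s a \<omega> \<noteq> {} \<and> t * real (card (visits s a \<omega>)) < \<phi> (total_noise s a \<omega>)} \<le> B"
  proof (rule measure_sampling_space_le[OF \<sigma>_pos events])
    fix x :: "nat \<Rightarrow> nat \<times> nat"
    let ?N = "Pi\<^sub>M {..<n} (\<lambda>_. noise \<sigma>)"
    define I where "I = {i. i < n \<and> x i = (s, a)}"
    have visits: "visits s a (\<lambda>i\<in>{..<n}. (x i, e i)) = I" for e :: "nat \<Rightarrow> real"
      by (auto simp: visits_def I_def)
    have noise: "total_noise s a (\<lambda>i\<in>{..<n}. (x i, e i)) = (\<Sum>i\<in>I. poly p (e i))" for e
      unfolding total_noise_def visits by (intro sum.cong refl) (auto simp: I_def p)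
    show "measure ?N {e \<in> space ?N. visits s a (\<lambda>i\<in>{..<n}. (x i, e i)) \<noteq> {} \<and>
        t * real (card (visits s a (\<lambda>i\<in>{..<n}. (x i, e i)))) < \<phi> (total_noise s a (\<lambda>i\<in>{..<n}. (x i, e i)))} \<le> B"
      unfolding visits noise using le[OF p(1), of I] B
      by (cases "I = {}") (auto simp: I_def)
  qed
qed

section \<open>Numbers of visits\<close>

lemma sampled_pairs_ne: "finite (sampled_pairs S A d)" "sampled_pairs S A d \<noteq> {}"
proof -
  show "finite (sampled_pairs S A d)"
    by (rule finite_subset[of _ "{1..S} \<times> {1..A}"]) (auto simp: sampled_pairs_def)
  have "set_pmf d \<subseteq> sampled_pairs S A d"
    using d_range by (auto simp: sampled_pairs_def pmf_positive_iff)
  then show "sampled_pairs S A d \<noteq> {}"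
    using set_pmf_not_empty[of d] by blast
qed

text \<open>The condition on the sample size in terms of \<open>L\<close>. The 2 inside its
  logarithm becomes \<open>ln 2\<close>, which pays for giving only half of
  \<open>\<delta> / (S * A)\<close> to the event of too few visits.\<close>

lemma expected_visits_gt:
  assumes "(s, a) \<in> sampled_pairs S A d"
  shows "8 * (L + ln 2) < real n * pmf d (s, a)"
proof -
  let ?m = "min_sampling_prob S A d"
  have "?m \<in> pmf d ` sampled_pairs S A d"
    unfolding min_sampling_prob_def using sampled_pairs_ne by (intro Min_in) auto
  then have m: "0 < ?m" by (auto simp: sampled_pairs_def)
  have le: "?m \<le> pmf d (s, a)"
    unfolding min_sampling_prob_def using sampled_pairs_ne assms by (intro Min_le) auto
  have "ln (2 * real (S * A) / \<delta>) = L + ln 2"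
    using S_A_pos \<delta> ln_mult[of 2 "real (S * A) / \<delta>"] by (simp add: L_def)
  then have "8 * (L + ln 2) < real n * ?m"
    using n_large m by (simp add: divide_less_eq)
  also have "\<dots> \<le> real n * pmf d (s, a)"
    using le by (intro mult_left_mono) auto
  finally show ?thesis .
qed

lemma few_visits_le:
  assumes "(s, a) \<in> sampled_pairs S A d"
  shows "{\<omega> \<in> space \<Omega>. real (card (visits s a \<omega>)) < real n * pmf d (s, a) / 2} \<in> events"
    and "prob {\<omega> \<in> space \<Omega>. real (card (visits s a \<omega>)) < real n * pmf d (s, a) / 2}
      \<le> \<delta> / real (S * A) / 2"
proof -
  show "{\<omega> \<in> space \<Omega>. real (card (visits s a \<omega>)) < real n * pmf d (s, a) / 2} \<in> events"
    by measurable
  have pos: "8 * (L + ln 2) < real n * pmf d (s, a)"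
    by (rule expected_visits_gt[OF assms])
  moreover have "0 < ln (2 :: real)" by simp
  ultimately have "0 < n" using L_pos by (cases n) auto
  then have "prob {\<omega> \<in> space \<Omega>. real (card (visits s a \<omega>)) < real n * pmf d (s, a) / 2}
      \<le> exp (- real n * pmf d (s, a) / 8)"
    unfolding visits_def by (rule measure_few_visits_le[OF \<sigma>_pos])
  also have "\<dots> \<le> exp (- L - ln 2)" using pos by simp
  also have "\<dots> = \<delta> / real (S * A) / 2" by (simp add: exp_diff exp_minus_L)
  finally show "prob {\<omega> \<in> space \<Omega>. real (card (visits s a \<omega>)) < real n * pmf d (s, a) / 2}
      \<le> \<delta> / real (S * A) / 2" .
qed

section \<open>Pessimistic rewards and the success event\<close>

abbreviation penalty :: "real \<Rightarrow> nat \<Rightarrow> real" where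
  "penalty c \<equiv> lcb_penalty c V q S A \<delta>"

lemma penalty_eq: "penalty c m = c * sqrt (V\<^sup>2 * L ^ q / real m)"
  by (simp add: lcb_penalty_def L_def)

definition radius :: "nat \<Rightarrow> nat \<Rightarrow> real" where
  "radius s a = sqrt (V\<^sup>2 * L ^ q / (real n * pmf d (s, a)))"

lemma visit_count_dataset: "visit_count n (dataset h r \<omega>) s a = card (visits s a \<omega>)"
proof -
  have "fst (dataset h r \<omega> i) = fst (\<omega> i)" for i
    by (simp add: dataset_def split: prod.split)
  then show ?thesis by (simp add: visit_count_def visits_def)
qed

lemma average_rating_dataset:
  assumes "visits s a \<omega> \<noteq> {}"
  shows "average_rating n (dataset h r \<omega>) s a =
    mean_rating h \<sigma> (r s a) + total_noise s a \<omega> / real (card (visits s a \<omega>))"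
proof -
  have fin: "finite (visits s a \<omega>)" by (simp add: visits_def)
  have eq: "{i. i < n \<and> fst (dataset h r \<omega> i) = (s, a)} = visits s a \<omega>"
    by (simp add: dataset_def visits_def case_prod_unfold)
  have "(\<Sum>i\<in>visits s a \<omega>. snd (dataset h r \<omega> i)) = (\<Sum>i\<in>visits s a \<omega>. h (r s a) (snd (\<omega> i)))"
    by (intro sum.cong refl) (auto simp: dataset_def visits_def split: prod.splits)
  also have "\<dots> = total_noise s a \<omega> + real (card (visits s a \<omega>)) * mean_rating h \<sigma> (r s a)"
    by (simp add: total_noise_def sum_subtractf)
  finally show ?thesis
    using assms fin unfolding average_rating_def visit_count_dataset eq by (simp add: add_divide_distrib)
qed

lemma lcb_reward_dataset:
  "lcb_reward b n (dataset h r \<omega>) s a =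
    (if visits s a \<omega> = {} then 0 else
      max (mean_rating h \<sigma> (r s a) + total_noise s a \<omega> / real (card (visits s a \<omega>))
        - b (card (visits s a \<omega>))) 0)"
proof -
  have "finite (visits s a \<omega>)" by (simp add: visits_def)
  then show ?thesis by (simp add: lcb_reward_def visit_count_dataset average_rating_dataset)
qed

text \<open>Every way of breaking ties has to obey the bound, hence the quantifier over
  \<open>f\<close> inside the event.\<close>

definition success :: "real \<Rightarrow> real \<Rightarrow> (nat \<Rightarrow> (nat \<times> nat) \<times> real) \<Rightarrow> bool" where
  "success c c0 \<omega> \<longleftrightarrow> (\<forall>f. lcb_output S A (penalty c) n (dataset h r \<omega>) f \<longrightarrow>
     SubOpt r \<rho> \<pi>opt (deterministic_policy f)
       \<le> c0 * (\<Sum>(s, a)\<in>sampled_pairs S A d. visitation \<rho> \<pi>opt s a *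
           mean_rating_inv R h \<sigma> (radius s a)))"

text \<open>The quantifier runs over uncountably many \<open>f\<close>. Neither the bound nor
  \<open>lcb_output\<close> looks at \<open>f\<close> outside \<open>{1..S}\<close>, which leaves
  finitely many functions, each with finitely many comparisons of measurable rewards.\<close>

lemma success_event: "{\<omega> \<in> space \<Omega>. success c c0 \<omega>} \<in> events"
proof -
  let ?F = "{1..S} \<rightarrow>\<^sub>E {1..A}"
  let ?bound = "\<lambda>f. SubOpt r \<rho> \<pi>opt (deterministic_policy f)
       \<le> c0 * (\<Sum>(s, a)\<in>sampled_pairs S A d. visitation \<rho> \<pi>opt s a *
           mean_rating_inv R h \<sigma> (radius s a))"
  have restr: "SubOpt r \<rho> \<pi>opt (deterministic_policy (restrict f {1..S}))
      = SubOpt r \<rho> \<pi>opt (deterministic_policy f)" for f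
    using bandit optimal
    by (simp add: SubOpt_eq_sum[of S A R] is_optimal_policy_def) (intro sum.cong; auto)
  have success: "success c c0 \<omega> \<longleftrightarrow>
      (\<forall>f\<in>?F. lcb_output S A (penalty c) n (dataset h r \<omega>) f \<longrightarrow> ?bound f)" for \<omega>
  proof
    assume *: "\<forall>f\<in>?F. lcb_output S A (penalty c) n (dataset h r \<omega>) f \<longrightarrow> ?bound f"
    show "success c c0 \<omega>"
      unfolding success_def
    proof (intro allI impI)
      fix f assume f: "lcb_output S A (penalty c) n (dataset h r \<omega>) f"
      then have "restrict f {1..S} \<in> ?F"
        by (auto simp: lcb_output_def is_arg_max_def)
      moreover have "lcb_output S A (penalty c) n (dataset h r \<omega>) (restrict f {1..S})"
        using f by (simp add: lcb_output_def)
      ultimately have "?bound (restrict f {1..S})" using * by blast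
      then show "?bound f" by (simp only: restr)
    qed
  qed (auto simp: success_def)
  have reward [measurable]: "(\<lambda>\<omega>. lcb_reward (penalty c) n (dataset h r \<omega>) s a) \<in> borel_measurable \<Omega>"
    if "s \<in> {1..S}" "a \<in> {1..A}" for s a
  proof -
    note [measurable] = measurable_total_noise[OF that]
    have empty: "visits s a \<omega> = {} \<longleftrightarrow> real (card (visits s a \<omega>)) = 0" for \<omega>
      by (simp add: visits_def)
    show ?thesis unfolding lcb_reward_dataset penalty_eq empty by measurable
  qed
  have arg_max: "lcb_output S A (penalty c) n (dataset h r \<omega>) f \<longleftrightarrow>
      (\<forall>s\<in>{1..S}. \<forall>a\<in>{1..A}. lcb_reward (penalty c) n (dataset h r \<omega>) s a
        \<le> lcb_reward (penalty c) n (dataset h r \<omega>) s (f s))" if "f \<in> ?F" for f \<omega>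
    using that by (fastforce simp: lcb_output_def is_arg_max_def not_less)
  have "{\<omega> \<in> space \<Omega>. lcb_output S A (penalty c) n (dataset h r \<omega>) f \<longrightarrow> ?bound f} \<in> events"
    if f: "f \<in> ?F" for f
  proof -
    have "{\<omega> \<in> space \<Omega>. lcb_reward (penalty c) n (dataset h r \<omega>) s a
        \<le> lcb_reward (penalty c) n (dataset h r \<omega>) s (f s)} \<in> events"
      if "s \<in> {1..S}" "a \<in> {1..A}" for s a
    proof -
      have "f s \<in> {1..A}" using f that(1) by (rule PiE_mem)
      then show ?thesis using reward[OF that] reward[OF that(1)] by (intro borel_measurable_le)
    qed
    then show ?thesis
      unfolding arg_max[OF f]
      by (intro sets.sets_Collect_imp sets.sets_Collect_finite_All sets.sets_Collect_const) auto
  qed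
  then show ?thesis
    unfolding success
    by (intro sets.sets_Collect_finite_All finite_PiE) (auto simp: PiE_eq_empty_iff)
qed

lemma R_nonneg: "0 \<le> R"
  using reward_range[of 1 1] S_A_pos by simp

lemma radius_nonneg: "0 \<le> radius s a"
  using L_pos by (simp add: radius_def)

lemma mean_rating_range: "x \<in> {0..R} \<Longrightarrow> mean_rating h \<sigma> x \<in> {0..R}"
  using rating_modelD(3)[OF model] by (simp add: image_subset_iff)

text \<open>The mean rating of \<open>a\<close>, lowered by noise and penalty, is at most the
  pessimistic reward of \<open>a\<close>, hence at most that of the chosen \<open>b\<close>, hence
  at most the mean rating of \<open>b\<close>. Overestimation has to be excluded for suboptimal
  \<open>b\<close> only, as another best action leaves no gap.\<close>

lemma reward_gap_lcb:
  assumes sa: "s \<in> {1..S}" "a \<in> {1..A}" "b \<in> {1..A}"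
    and best: "best_action s a" and sampled: "(s, a) \<in> sampled_pairs S A d"
    and K: "0 \<le> K" and c: "0 \<le> c"
    and many: "real n * pmf d (s, a) / 2 \<le> real (card (visits s a \<omega>))"
    and accurate: "(total_noise s a \<omega>)\<^sup>2 \<le> K\<^sup>2 * (real (card (visits s a \<omega>)) * (V\<^sup>2 * L ^ q))"
    and pessimistic: "\<not> best_action s b \<Longrightarrow> visits s b \<omega> \<noteq> {} \<Longrightarrow>
      total_noise s b \<omega> \<le> c * sqrt (real (card (visits s b \<omega>)) * (V\<^sup>2 * L ^ q))"
    and chosen: "lcb_reward (penalty c) n (dataset h r \<omega>) s a
      \<le> lcb_reward (penalty c) n (dataset h r \<omega>) s b"
  shows "r s a - r s b \<le> real (nat \<lceil>2 * (K + c)\<rceil>) * C1\<^sup>2 * mean_rating_inv R h \<sigma> (radius s a)"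
proof (cases "best_action s b")
  case True
  then have "r s a - r s b \<le> 0" using sa by (simp add: best_action_def)
  also have "0 \<le> real (nat \<lceil>2 * (K + c)\<rceil>) * C1\<^sup>2 * mean_rating_inv R h \<sigma> (radius s a)"
    using mean_rating_inv_nonneg[OF R_nonneg rating_modelD(5)[OF model] radius_nonneg] by simp
  finally show ?thesis .
next
  case False
  let ?W = "V\<^sup>2 * L ^ q" and ?m = "real (card (visits s a \<omega>))"
  have W: "0 \<le> ?W" using L_pos by simp
  have "0 < 8 * (L + ln 2)" using L_pos by (simp add: add_pos_pos)
  then have nd: "0 < real n * pmf d (s, a)"
    using expected_visits_gt[OF sampled] by (rule less_trans)
  then have m: "0 < ?m" using many by linarith
  then have ne: "visits s a \<omega> \<noteq> {}" by auto
  have scale: "sqrt (x * ?W) / x = sqrt (?W / x)" if "0 < x" for x :: real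
    using that by (simp add: real_sqrt_mult real_sqrt_divide real_div_sqrt field_simps)
  have "\<bar>total_noise s a \<omega>\<bar> \<le> K * sqrt (?m * ?W)"
    using real_sqrt_le_mono[OF accurate] K by (simp add: real_sqrt_mult)
  then have "- (K * sqrt (?m * ?W)) / ?m \<le> total_noise s a \<omega> / ?m"
    using m by (intro divide_right_mono) auto
  then have noise: "- (K * sqrt (?W / ?m)) \<le> total_noise s a \<omega> / ?m"
    using scale[OF m] by (metis minus_divide_left times_divide_eq_right)
  have "?W / ?m \<le> ?W / (real n * pmf d (s, a) / 2)"
    using W nd many m by (intro divide_left_mono) auto
  \<comment> \<open>The factor 2, due to half the expected visits, is enlarged to 4 for the sake of
    its root; this is the 2 in \<open>2 * (K + c)\<close>.\<close>
  also have "\<dots> \<le> 4 * (?W / (real n * pmf d (s, a)))"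
    using W nd by (simp add: field_simps)
  finally have "sqrt (?W / ?m) \<le> sqrt (4 * (?W / (real n * pmf d (s, a))))"
    by (rule real_sqrt_le_mono)
  also have "\<dots> = 2 * radius s a"
    unfolding radius_def by (subst real_sqrt_mult) simp
  finally have "(K + c) * sqrt (?W / ?m) \<le> (K + c) * (2 * radius s a)"
    using K c by (intro mult_left_mono) auto
  moreover have "mean_rating h \<sigma> (r s a) - (K + c) * sqrt (?W / ?m)
      \<le> lcb_reward (penalty c) n (dataset h r \<omega>) s a"
    using noise ne by (simp add: lcb_reward_dataset penalty_eq algebra_simps)
  \<comment> \<open>An unvisited action has reward 0, and a visited one may be truncated at 0; both
    are harmless because mean ratings are nonnegative.\<close>
  moreover have "lcb_reward (penalty c) n (dataset h r \<omega>) s b \<le> mean_rating h \<sigma> (r s b)"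
  proof (cases "visits s b \<omega> = {}")
    case True
    then show ?thesis
      using mean_rating_range[OF reward_range[OF sa(1,3)]] by (simp add: lcb_reward_dataset)
  next
    case ne: False
    have "finite (visits s b \<omega>)" by (simp add: visits_def)
    then have m: "0 < real (card (visits s b \<omega>))" using ne by (simp add: card_gt_0_iff)
    have "total_noise s b \<omega> / real (card (visits s b \<omega>))
        \<le> c * sqrt (real (card (visits s b \<omega>)) * ?W) / real (card (visits s b \<omega>))"
      using pessimistic[OF False ne] m by (intro divide_right_mono) auto
    also have "\<dots> = c * sqrt (?W / real (card (visits s b \<omega>)))"
      using scale[OF m] by (metis times_divide_eq_right)
    finally show ?thesis
      using mean_rating_range[OF reward_range[OF sa(1,3)]] ne
      by (simp add: lcb_reward_dataset penalty_eq)
  qed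
  ultimately have "mean_rating h \<sigma> (r s a) - mean_rating h \<sigma> (r s b) \<le> 2 * (K + c) * radius s a"
    using chosen by (simp add: algebra_simps)
  then show ?thesis
    using best sa K c radius_nonneg
    by (intro reward_gap_le[OF model reward_range reward_range]) (auto simp: best_action_def)
qed

lemma best_action_if_visitation_pos:
  assumes "s \<in> {1..S}" "a \<in> {1..A}" "0 < visitation \<rho> \<pi>opt s a"
  shows "best_action s a" and "(s, a) \<in> sampled_pairs S A d"
proof -
  have "pmf (\<pi>opt s) a \<noteq> 0" using assms(3) by (auto simp: visitation_def)
  then have "0 < pmf (\<pi>opt s) a" by (simp add: less_le)
  then show "best_action s a"
    using optimal_policy_support[OF optimal assms(1)] by (simp add: best_action_def)
  show "(s, a) \<in> sampled_pairs S A d"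
    using coverage[OF assms] assms by (simp add: sampled_pairs_def)
qed

lemma visitation_nonneg: "0 \<le> visitation \<rho> \<pi>opt s a"
  by (simp add: visitation_def)

text \<open>Coverage makes the visitation vanish outside \<open>sampled_pairs\<close>. Among the
  remaining pairs only those of positive visitation need a gap bound, and their actions are
  best.\<close>

lemma success_if_gaps_le:
  assumes gap: "\<And>f s a. lcb_output S A (penalty c) n (dataset h r \<omega>) f \<Longrightarrow>
      s \<in> {1..S} \<Longrightarrow> a \<in> {1..A} \<Longrightarrow> f s \<in> {1..A} \<Longrightarrow> best_action s a \<Longrightarrow> (s, a) \<in> sampled_pairs S A d \<Longrightarrow>
      lcb_reward (penalty c) n (dataset h r \<omega>) s a \<le> lcb_reward (penalty c) n (dataset h r \<omega>) s (f s) \<Longrightarrow>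
      r s a - r s (f s) \<le> c0 * mean_rating_inv R h \<sigma> (radius s a)"
  shows "success c c0 \<omega>"
  unfolding success_def
proof (intro allI impI)
  fix f assume f: "lcb_output S A (penalty c) n (dataset h r \<omega>) f"
  let ?inv = "\<lambda>s a. mean_rating_inv R h \<sigma> (radius s a)"
  have "SubOpt r \<rho> \<pi>opt (deterministic_policy f)
      = (\<Sum>(s, a)\<in>{1..S} \<times> {1..A}. visitation \<rho> \<pi>opt s a * (r s a - r s (f s)))"
    using optimal by (intro SubOpt_eq_sum[OF bandit]) (simp add: is_optimal_policy_def)
  also have "\<dots> = (\<Sum>(s, a)\<in>sampled_pairs S A d. visitation \<rho> \<pi>opt s a * (r s a - r s (f s)))"
  proof (rule sum.mono_neutral_right)
    show "sampled_pairs S A d \<subseteq> {1..S} \<times> {1..A}" by (auto simp: sampled_pairs_def)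
    show "\<forall>z\<in>{1..S} \<times> {1..A} - sampled_pairs S A d.
        (case z of (s, a) \<Rightarrow> visitation \<rho> \<pi>opt s a * (r s a - r s (f s))) = 0"
      using best_action_if_visitation_pos(2) visitation_nonneg by (force simp: less_le)
  qed simp
  also have "\<dots> \<le> (\<Sum>(s, a)\<in>sampled_pairs S A d. visitation \<rho> \<pi>opt s a * (c0 * ?inv s a))"
  proof (intro sum_mono, clarify)
    fix s a assume sampled: "(s, a) \<in> sampled_pairs S A d"
    then have sa: "s \<in> {1..S}" "a \<in> {1..A}" by (auto simp: sampled_pairs_def)
    show "visitation \<rho> \<pi>opt s a * (r s a - r s (f s)) \<le> visitation \<rho> \<pi>opt s a * (c0 * ?inv s a)"
    proof (cases "visitation \<rho> \<pi>opt s a = 0")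
      case False
      then have best: "best_action s a"
        using best_action_if_visitation_pos(1)[OF sa] visitation_nonneg[of s a] by simp
      have "is_arg_max (lcb_reward (penalty c) n (dataset h r \<omega>) s) (\<lambda>a. a \<in> {1..A}) (f s)"
        using f sa by (simp add: lcb_output_def)
      then have "f s \<in> {1..A}"
        "lcb_reward (penalty c) n (dataset h r \<omega>) s a \<le> lcb_reward (penalty c) n (dataset h r \<omega>) s (f s)"
        using sa by (auto simp: is_arg_max_def not_less)
      then show ?thesis
        using gap[OF f sa _ best sampled] visitation_nonneg by (intro mult_left_mono) auto
    qed simp
  qed
  also have "\<dots> = c0 * (\<Sum>(s, a)\<in>sampled_pairs S A d. visitation \<rho> \<pi>opt s a * ?inv s a)"
    by (simp add: sum_distrib_left case_prod_unfold mult_ac)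
  finally show "SubOpt r \<rho> \<pi>opt (deterministic_policy f)
      \<le> c0 * (\<Sum>(s, a)\<in>sampled_pairs S A d. visitation \<rho> \<pi>opt s a * ?inv s a)" .
qed

text \<open>A union bound with a budget \<open>\<beta>\<close> that may vary between pairs: for
  \<open>L < 1\<close> the bound one half for a suboptimal pair exceeds a uniform share of
  \<open>\<delta>\<close>.\<close>

lemma prob_success_ge:
  assumes Bad: "\<And>z. z \<in> {1..S} \<times> {1..A} \<Longrightarrow> Bad z \<in> events"
    and le: "\<And>z. z \<in> {1..S} \<times> {1..A} \<Longrightarrow> prob (Bad z) \<le> \<beta> z"
    and sum: "sum \<beta> ({1..S} \<times> {1..A}) \<le> \<delta>"
    and good: "\<And>\<omega>. \<omega> \<in> space \<Omega> \<Longrightarrow> (\<And>s a. s \<in> {1..S} \<Longrightarrow> a \<in> {1..A} \<Longrightarrow> \<omega> \<notin> Bad (s, a)) \<Longrightarrow>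
      success c c0 \<omega>"
  shows "1 - \<delta> \<le> prob {\<omega> \<in> space \<Omega>. success c c0 \<omega>}"
proof -
  let ?Z = "{1..S} \<times> {1..A}" and ?E = "{\<omega> \<in> space \<Omega>. success c c0 \<omega>}"
  have "1 - prob ?E = prob (space \<Omega> - ?E)"
    by (simp add: prob_compl[OF success_event])
  also have "\<dots> \<le> prob (\<Union>z\<in>?Z. Bad z)"
  proof (rule finite_measure_mono)
    show "space \<Omega> - ?E \<subseteq> (\<Union>z\<in>?Z. Bad z)"
      using good by fast
  qed (use Bad in \<open>auto intro!: sets.finite_UN\<close>)
  also have "\<dots> \<le> (\<Sum>z\<in>?Z. prob (Bad z))"
    using Bad by (intro finite_measure_subadditive_finite) auto
  also have "\<dots> \<le> \<delta>"
    using le sum by (meson order_trans sum_mono)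
  finally show ?thesis by simp
qed

section \<open>Failure events and the constants\<close>

definition noise_exceeds :: "(real \<Rightarrow> real) \<Rightarrow> real \<Rightarrow> nat \<Rightarrow> nat \<Rightarrow> (nat \<Rightarrow> (nat \<times> nat) \<times> real) set" where
  "noise_exceeds \<phi> t s a = {\<omega> \<in> space \<Omega>. visits s a \<omega> \<noteq> {} \<and>
     t * real (card (visits s a \<omega>)) < \<phi> (total_noise s a \<omega>)}"

text \<open>Empty for unsampled pairs, so that one probability bound holds for all pairs.\<close>

definition few_visits :: "nat \<Rightarrow> nat \<Rightarrow> (nat \<Rightarrow> (nat \<times> nat) \<times> real) set" where
  "few_visits s a = (if (s, a) \<in> sampled_pairs S A d
     then {\<omega> \<in> space \<Omega>. real (card (visits s a \<omega>)) < real n * pmf d (s, a) / 2} else {})"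

lemma few_visits:
  shows "few_visits s a \<in> events" and "prob (few_visits s a) \<le> \<delta> / real (S * A) / 2"
  using few_visits_le[of s a] \<delta> by (simp_all add: few_visits_def)

lemma noise_exceeds_exp:
  assumes "s \<in> {1..S}" "a \<in> {1..A}" and "1 \<le> L"
  shows "noise_exceeds power2 (16 * exp 400 * (V\<^sup>2 * L ^ q)) s a \<in> events"
    and "prob (noise_exceeds power2 (16 * exp 400 * (V\<^sup>2 * L ^ q)) s a) \<le> exp (- 4 * L)"
proof -
  have le: "measure (Pi\<^sub>M {..<n} (\<lambda>_. noise \<sigma>)) {e \<in> space (Pi\<^sub>M {..<n} (\<lambda>_. noise \<sigma>)).
      16 * exp 400 * (V\<^sup>2 * L ^ q) * real (card I) < (\<Sum>i\<in>I. poly p (e i))\<^sup>2} \<le> exp (- 4 * L)"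
    if "centred_symmetric_polynomial \<sigma> V p q" "I \<subseteq> {..<n}" "I \<noteq> {}" for p I
    using centred_symmetric_polynomial.prob_sum_gt_le_exp[OF that assms(3)]
    by (simp only: mult_ac)
  have [measurable]: "power2 \<in> borel_measurable (borel :: real measure)" by measurable
  show "noise_exceeds power2 (16 * exp 400 * (V\<^sup>2 * L ^ q)) s a \<in> events"
    and "prob (noise_exceeds power2 (16 * exp 400 * (V\<^sup>2 * L ^ q)) s a) \<le> exp (- 4 * L)"
    unfolding noise_exceeds_def
    by (rule noise_event_le[OF assms(1,2) _ _ le]; simp)+
qed

lemma noise_exceeds_chebyshev:
  assumes "s \<in> {1..S}" "a \<in> {1..A}"
  shows "noise_exceeds power2 (100 * V\<^sup>2) s a \<in> events"
    and "prob (noise_exceeds power2 (100 * V\<^sup>2) s a) \<le> 1 / 100"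
proof -
  have le: "measure (Pi\<^sub>M {..<n} (\<lambda>_. noise \<sigma>)) {e \<in> space (Pi\<^sub>M {..<n} (\<lambda>_. noise \<sigma>)).
      100 * V\<^sup>2 * real (card I) < (\<Sum>i\<in>I. poly p (e i))\<^sup>2} \<le> 1 / 100"
    if "centred_symmetric_polynomial \<sigma> V p q" "I \<subseteq> {..<n}" "I \<noteq> {}" for p I
    using centred_symmetric_polynomial.prob_sum_gt_le_chebyshev[OF that]
    by (simp only: mult_ac)
  show "noise_exceeds power2 (100 * V\<^sup>2) s a \<in> events"
    and "prob (noise_exceeds power2 (100 * V\<^sup>2) s a) \<le> 1 / 100"
    unfolding noise_exceeds_def
    by (rule noise_event_le[OF assms _ _ le]; simp)+
qed

lemma noise_exceeds_symmetric:
  assumes "s \<in> {1..S}" "a \<in> {1..A}"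
  shows "noise_exceeds (\<lambda>x. x) 0 s a \<in> events"
    and "prob (noise_exceeds (\<lambda>x. x) 0 s a) \<le> 1 / 2"
proof -
  have le: "measure (Pi\<^sub>M {..<n} (\<lambda>_. noise \<sigma>)) {e \<in> space (Pi\<^sub>M {..<n} (\<lambda>_. noise \<sigma>)).
      0 * real (card I) < (\<Sum>i\<in>I. poly p (e i))} \<le> 1 / 2"
    if "centred_symmetric_polynomial \<sigma> V p q" "I \<subseteq> {..<n}" "I \<noteq> {}" for p I
    using centred_symmetric_polynomial.prob_sum_pos_le[OF that(1,2)] by simp
  show "noise_exceeds (\<lambda>x. x) 0 s a \<in> events"
    and "prob (noise_exceeds (\<lambda>x. x) 0 s a) \<le> 1 / 2"
    unfolding noise_exceeds_def
    by (rule noise_event_le[OF assms _ _ le]; simp)+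
qed

text \<open>The first summand is the root of the tail factor \<open>16 * exp 400\<close>. The second
  serves \<open>L < 1\<close> with two actions, where \<open>1 / 2 <= L\<close> gives
  \<open>100 <= (10 * 2 ^ q)^2 * L ^ q\<close>.\<close>

definition noise_factor :: real where "noise_factor = 4 * exp 200 + 10 * 2 ^ q"

definition gap_factor :: real where
  "gap_factor = real (nat \<lceil>2 * (noise_factor + 4 * exp 200)\<rceil>) * C1\<^sup>2"

lemma noise_factor_square: "16 * exp 400 \<le> noise_factor\<^sup>2" "100 * 4 ^ q \<le> noise_factor\<^sup>2"
proof -
  have "16 * exp 400 = (4 * exp 200 :: real)\<^sup>2"
    by (simp add: power_mult_distrib exp_of_nat_mult[symmetric] flip: exp_double)
  also have "\<dots> \<le> noise_factor\<^sup>2" by (intro power_mono) (auto simp: noise_factor_def)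
  finally show "16 * exp 400 \<le> noise_factor\<^sup>2" .
  have "100 * 4 ^ q = (10 * 2 ^ q :: real)\<^sup>2"
    by (simp add: power_mult_distrib power_mult[symmetric] mult.commute[of q] power_mult)
  also have "\<dots> \<le> noise_factor\<^sup>2" by (intro power_mono) (auto simp: noise_factor_def)
  finally show "100 * 4 ^ q \<le> noise_factor\<^sup>2" .
qed

text \<open>Best actions need enough visits and a two-sided estimate, lest their pessimistic reward
  be too small; the others need an upper estimate only, but with the constant of the
  penalty.\<close>

lemma success_if_good:
  assumes best: "\<And>s a. s \<in> {1..S} \<Longrightarrow> a \<in> {1..A} \<Longrightarrow> best_action s a \<Longrightarrow> visits s a \<omega> \<noteq> {} \<Longrightarrow>
      (total_noise s a \<omega>)\<^sup>2 \<le> noise_factor\<^sup>2 * (real (card (visits s a \<omega>)) * (V\<^sup>2 * L ^ q))"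
    and many: "\<And>s a. s \<in> {1..S} \<Longrightarrow> a \<in> {1..A} \<Longrightarrow> best_action s a \<Longrightarrow> \<omega> \<notin> few_visits s a"
    and other: "\<And>s a. s \<in> {1..S} \<Longrightarrow> a \<in> {1..A} \<Longrightarrow> \<not> best_action s a \<Longrightarrow> visits s a \<omega> \<noteq> {} \<Longrightarrow>
      total_noise s a \<omega> \<le> 4 * exp 200 * sqrt (real (card (visits s a \<omega>)) * (V\<^sup>2 * L ^ q))"
    and \<omega>: "\<omega> \<in> space \<Omega>"
  shows "success (4 * exp 200) gap_factor \<omega>"
proof (rule success_if_gaps_le)
  fix f s a
  assume *: "s \<in> {1..S}" "a \<in> {1..A}" "f s \<in> {1..A}" "best_action s a" "(s, a) \<in> sampled_pairs S A d"
    "lcb_reward (penalty (4 * exp 200)) n (dataset h r \<omega>) s a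
      \<le> lcb_reward (penalty (4 * exp 200)) n (dataset h r \<omega>) s (f s)"
  have visits: "real n * pmf d (s, a) / 2 \<le> real (card (visits s a \<omega>))"
    using many[OF *(1,2,4)] *(5) \<omega> by (simp add: few_visits_def not_less)
  have accurate: "(total_noise s a \<omega>)\<^sup>2 \<le> noise_factor\<^sup>2 * (real (card (visits s a \<omega>)) * (V\<^sup>2 * L ^ q))"
    using best[OF *(1,2,4)] by (cases "visits s a \<omega> = {}") (auto simp: total_noise_def)
  show "r s a - r s (f s) \<le> gap_factor * mean_rating_inv R h \<sigma> (radius s a)"
    unfolding gap_factor_def
    by (rule reward_gap_lcb[OF *(1-5) _ _ visits accurate other[OF *(1,3)] *(6)])
       (auto simp: noise_factor_def)
qed

section \<open>The probability of success in each range of \<open>L\<close> and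
  \<open>A\<close>\<close>

lemma prob_success_large:
  assumes L: "1 \<le> L"
  shows "1 - \<delta> \<le> prob {\<omega> \<in> space \<Omega>. success (4 * exp 200) gap_factor \<omega>}"
proof (rule prob_success_ge)
  let ?t = "16 * exp 400 * (V\<^sup>2 * L ^ q)"
  let ?Bad = "\<lambda>(s, a). noise_exceeds power2 ?t s a \<union> few_visits s a"
  fix z assume z: "z \<in> {1..S} \<times> {1..A}"
  then obtain s a where sa: "z = (s, a)" "s \<in> {1..S}" "a \<in> {1..A}" by auto
  note ev = noise_exceeds_exp[OF sa(2,3) L] few_visits[of s a]
  show "?Bad z \<in> events" using ev by (auto simp: sa)
  have "prob (?Bad z) \<le> prob (noise_exceeds power2 ?t s a) + prob (few_visits s a)"
    using ev by (auto simp: sa intro: measure_Un_le)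
  also have "\<dots> \<le> exp (- 4 * L) + \<delta> / real (S * A) / 2"
    using ev by (intro add_mono) auto
  also have "exp (- 4 * L) \<le> \<delta> / real (S * A) / 2"
  proof -
    \<comment> \<open>As \<open>3 * L >= ln 2\<close>, the noise takes at most the other half of the
      share \<open>\<delta> / (S * A)\<close>.\<close>
    have "exp (- 4 * L) \<le> exp (- L - ln 2)"
      using L ln_2_less_1 by simp
    then show ?thesis by (simp add: exp_diff exp_minus_L)
  qed
  finally show "prob (?Bad z) \<le> \<delta> / real (S * A)" by (simp add: mult.commute)
next
  show "(\<Sum>z\<in>{1..S} \<times> {1..A}. \<delta> / real (S * A)) \<le> \<delta>"
    using S_A_pos by (simp add: card_cartesian_product)
next
  let ?t = "16 * exp 400 * (V\<^sup>2 * L ^ q)"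
  fix \<omega> assume \<omega>: "\<omega> \<in> space \<Omega>"
    and good: "\<And>s a. s \<in> {1..S} \<Longrightarrow> a \<in> {1..A} \<Longrightarrow>
      \<omega> \<notin> (case (s, a) of (s, a) \<Rightarrow> noise_exceeds power2 ?t s a \<union> few_visits s a)"
  have W: "0 \<le> V\<^sup>2 * L ^ q" using L by simp
  have noise: "(total_noise s a \<omega>)\<^sup>2 \<le> ?t * real (card (visits s a \<omega>))"
    if "s \<in> {1..S}" "a \<in> {1..A}" "visits s a \<omega> \<noteq> {}" for s a
    using good[OF that(1,2)] that(3) \<omega> by (simp add: noise_exceeds_def not_less)
  show "success (4 * exp 200) gap_factor \<omega>"
  proof (rule success_if_good[OF _ _ _ \<omega>])
    fix s a assume sa: "s \<in> {1..S}" "a \<in> {1..A}"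
    show "\<omega> \<notin> few_visits s a" using good[OF sa] by simp
    assume ne: "visits s a \<omega> \<noteq> {}"
    let ?X = "real (card (visits s a \<omega>)) * (V\<^sup>2 * L ^ q)"
    have X: "0 \<le> ?X" using W by simp
    have le: "(total_noise s a \<omega>)\<^sup>2 \<le> 16 * exp 400 * ?X"
      using noise[OF sa ne] by (simp only: mult_ac)
    also have "\<dots> \<le> noise_factor\<^sup>2 * ?X"
      using X noise_factor_square(1) by (rule mult_right_mono[rotated])
    finally show "(total_noise s a \<omega>)\<^sup>2 \<le> noise_factor\<^sup>2 * ?X" .
    have "(total_noise s a \<omega>) \<le> sqrt (16 * exp 400 * ?X)"
      by (rule real_le_rsqrt[OF le])
    also have "\<dots> = 4 * exp 200 * sqrt ?X"
    proof -
      have "16 * exp 400 = (4 * exp 200 :: real)\<^sup>2"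
        by (simp add: power_mult_distrib flip: exp_double)
      then have "sqrt (16 * exp 400) = (4 * exp 200 :: real)"
        by (intro real_sqrt_unique) auto
      then show ?thesis by (simp only: real_sqrt_mult[of "16 * exp 400" ?X])
    qed
    finally show "total_noise s a \<omega> \<le> 4 * exp 200 * sqrt ?X" .
  qed
qed

text \<open>
  As \<open>S A / \<delta> < e\<close>, there are one state and two actions, and \<open>\<delta>\<close> exceeds \<open>2 / e\<close>. The
  penalty may be far too small to dominate the noise of the suboptimal action, but that noise is
  nonpositive with probability at least one half.
\<close>

lemma prob_success_small:
  assumes L: "L < 1" and A: "2 \<le> A"
  shows "1 - \<delta> \<le> prob {\<omega> \<in> space \<Omega>. success (4 * exp 200) gap_factor \<omega>}"
proof -
  have pos: "0 < real (S * A)" using S_A_pos by simp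
  have "exp (- 1) < exp (- L)" using L by simp
  then have "1 / exp 1 < \<delta> / real (S * A)"
    by (simp only: exp_minus_L exp_minus[of 1] inverse_eq_divide)
  then have SA: "real (S * A) < exp 1 * \<delta>"
    using pos by (simp add: field_simps del: of_nat_mult)
  have exp_\<delta>: "exp 1 * \<delta> < 272 / 100 * \<delta>" using e_less_272 \<delta> by (intro mult_strict_right_mono) auto
  then have "real (S * A) < 3" using SA \<delta> by linarith
  then have "S * A < 3" by (simp only: of_nat_less_numeral_iff)
  moreover have "S * 2 \<le> S * A" using A by simp
  ultimately have "S * 2 < 3" by linarith
  then have S: "S = 1" using S_A_pos by linarith
  have A: "A = 2" using \<open>S * A < 3\<close> A by (simp add: S)
  note dims = S A
  \<comment> \<open>The union bound with one suboptimal action needs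
    \<open>1 / 100 + \<delta> / 4 + 1 / 2 <= \<delta>\<close>, that is,
    \<open>\<delta> >= 0.68\<close>; the available \<open>\<delta> > 2 / 2.72\<close> leaves some
    room.\<close>
  have \<delta>_large: "2 / 3 + 1 / 50 < \<delta>" using SA exp_\<delta> by (simp add: dims)
  have "L = ln (2 / \<delta>)" unfolding L_def by (simp add: dims)
  moreover have "ln 2 \<le> ln (2 / \<delta>)" using \<delta> by (simp add: field_simps)
  ultimately have L_half: "1 / 2 \<le> L" using ln2_ge_two_thirds by linarith
  define Bad where "Bad = (\<lambda>(s, a). if best_action s a
    then noise_exceeds power2 (100 * V\<^sup>2) s a \<union> few_visits s a else noise_exceeds (\<lambda>x. x) 0 s a)"
  define \<beta> where "\<beta> = (\<lambda>(s, a). if best_action s a then 1 / 100 + \<delta> / 4 else 1 / 2)"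
  show ?thesis
  proof (rule prob_success_ge)
    fix z assume z: "z \<in> {1..S} \<times> {1..A}"
    then obtain s a where sa: "z = (s, a)" "s \<in> {1..S}" "a \<in> {1..A}" by auto
    note ev = noise_exceeds_chebyshev[OF sa(2,3)] noise_exceeds_symmetric[OF sa(2,3)] few_visits[of s a]
    show "Bad z \<in> events" using ev by (auto simp: sa Bad_def)
    show "prob (Bad z) \<le> \<beta> z"
    proof (cases "best_action s a")
      case True
      then have "prob (Bad z) \<le> prob (noise_exceeds power2 (100 * V\<^sup>2) s a) + prob (few_visits s a)"
        using ev by (auto simp: sa Bad_def intro: measure_Un_le)
      also have "\<dots> \<le> 1 / 100 + \<delta> / 4"
        using ev by (intro add_mono) (auto simp: dims)
      finally show ?thesis using True by (simp add: sa \<beta>_def)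
    next
      case False
      then show ?thesis using ev by (simp add: sa Bad_def \<beta>_def)
    qed
  next
    have "{1..S} \<times> {1..A} = {(1, 1), (1, 2)}" by (auto simp: dims)
    then have "sum \<beta> ({1..S} \<times> {1..A}) = \<beta> (1, 1) + \<beta> (1, 2)" by simp
    \<comment> \<open>At least one of the two actions is best, so the costly share 1/2 is spent at
      most once.\<close>
    moreover have "best_action 1 1 \<or> best_action 1 2"
    proof -
      have "{1..A} = {1, 2}" by (auto simp: dims)
      then show ?thesis by (auto simp: best_action_def)
    qed
    ultimately show "sum \<beta> ({1..S} \<times> {1..A}) \<le> \<delta>"
      using \<delta>_large by (auto simp: \<beta>_def)
  next
    fix \<omega> assume \<omega>: "\<omega> \<in> space \<Omega>"
      and good: "\<And>s a. s \<in> {1..S} \<Longrightarrow> a \<in> {1..A} \<Longrightarrow> \<omega> \<notin> Bad (s, a)"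
    show "success (4 * exp 200) gap_factor \<omega>"
    proof (rule success_if_good[OF _ _ _ \<omega>])
      fix s a assume sa: "s \<in> {1..S}" "a \<in> {1..A}" and best: "best_action s a"
      show "\<omega> \<notin> few_visits s a" using good[OF sa] best by (simp add: Bad_def)
      assume ne: "visits s a \<omega> \<noteq> {}"
      let ?X = "real (card (visits s a \<omega>)) * V\<^sup>2"
      have "(total_noise s a \<omega>)\<^sup>2 \<le> 100 * V\<^sup>2 * real (card (visits s a \<omega>))"
        using good[OF sa] best ne \<omega> by (simp add: Bad_def noise_exceeds_def not_less)
      then have "(total_noise s a \<omega>)\<^sup>2 \<le> 100 * ?X" by (simp only: mult_ac)
      also have "100 * ?X \<le> noise_factor\<^sup>2 * L ^ q * ?X"
      proof (rule mult_right_mono)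
        have "100 * 1 \<le> 100 * (2 :: real) ^ q" by (intro mult_left_mono) auto
        also have "\<dots> = 100 * 4 ^ q * (1 / 2) ^ q"
          by (simp add: mult.assoc flip: power_mult_distrib)
        also have "\<dots> \<le> noise_factor\<^sup>2 * L ^ q"
          using noise_factor_square(2) L_half by (intro mult_mono power_mono) auto
        finally show "100 \<le> noise_factor\<^sup>2 * L ^ q" by simp
      qed simp
      finally show "(total_noise s a \<omega>)\<^sup>2
          \<le> noise_factor\<^sup>2 * (real (card (visits s a \<omega>)) * (V\<^sup>2 * L ^ q))"
        by (simp only: mult_ac)
    next
      fix s a assume sa: "s \<in> {1..S}" "a \<in> {1..A}" and nbest: "\<not> best_action s a"
        and ne: "visits s a \<omega> \<noteq> {}"
      have "total_noise s a \<omega> \<le> 0"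
        using good[OF sa] nbest ne \<omega> by (simp add: Bad_def noise_exceeds_def not_less)
      also have "0 \<le> 4 * exp 200 * sqrt (real (card (visits s a \<omega>)) * (V\<^sup>2 * L ^ q))"
        using L_pos by simp
      finally show "total_noise s a \<omega> \<le> 4 * exp 200 * sqrt (real (card (visits s a \<omega>)) * (V\<^sup>2 * L ^ q))" .
    qed
  qed
qed

text \<open>The only action is always chosen, so every gap is zero with certainty. Splitting this
  off leaves at least two actions when \<open>L < 1\<close>.\<close>

lemma prob_success_one_action:
  assumes "A = 1"
  shows "1 - \<delta> \<le> prob {\<omega> \<in> space \<Omega>. success (4 * exp 200) gap_factor \<omega>}"
proof -
  have "success (4 * exp 200) gap_factor \<omega>" for \<omega>
  proof (rule success_if_gaps_le)
    fix f :: "nat \<Rightarrow> nat" and s a :: nat assume "a \<in> {1..A}" "f s \<in> {1..A}"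
    then have "r s a - r s (f s) = 0" using assms by simp
    also have "0 \<le> gap_factor * mean_rating_inv R h \<sigma> (radius s a)"
      using mean_rating_inv_nonneg[OF R_nonneg rating_modelD(5)[OF model] radius_nonneg]
      by (simp add: gap_factor_def)
    finally show "r s a - r s (f s) \<le> gap_factor * mean_rating_inv R h \<sigma> (radius s a)" .
  qed
  then show ?thesis using \<delta> by (simp add: prob_space)
qed

lemma prob_success: "1 - \<delta> \<le> prob {\<omega> \<in> space \<Omega>. success (4 * exp 200) gap_factor \<omega>}"
  using prob_success_one_action prob_success_small prob_success_large S_A_pos
  by (cases "A = 1"; cases "L < 1") auto

lemma success_mono:
  assumes "success c c0 \<omega>" and "c0 \<le> c1"
  shows "success c c1 \<omega>"
proof -
  have "0 \<le> (\<Sum>(s, a)\<in>sampled_pairs S A d. visitation \<rho> \<pi>opt s a * mean_rating_inv R h \<sigma> (radius s a))"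
    using visitation_nonneg mean_rating_inv_nonneg[OF R_nonneg rating_modelD(5)[OF model] radius_nonneg]
    by (intro sum_nonneg) auto
  then show ?thesis
    using assms unfolding success_def by (meson mult_right_mono order_trans)
qed

end

theorem theorem3:
  "\<exists>c_b>0. \<forall>(q::nat) (C1::real) (C2::real). \<exists>c_0>0.
     \<forall>(S::nat) (A::nat) (R::real) (r :: nat \<Rightarrow> nat \<Rightarrow> real) (\<rho> :: nat pmf)
      (\<sigma>::real) (h :: real \<Rightarrow> real \<Rightarrow> real) (V::real) (d :: (nat \<times> nat) pmf)
      (\<pi>opt :: nat \<Rightarrow> nat pmf) (\<delta>::real) (n::nat).
       contextual_bandit S A R r \<rho> \<longrightarrow>
       rating_model q R \<sigma> h C1 C2 \<longrightarrow>
       (\<forall>x\<in>{0..R}. rating_variance h \<sigma> x \<le> V\<^sup>2) \<longrightarrow>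
       set_pmf d \<subseteq> {1..S} \<times> {1..A} \<longrightarrow>
       is_optimal_policy S A r \<pi>opt \<longrightarrow>
       (\<forall>s\<in>{1..S}. \<forall>a\<in>{1..A}. visitation \<rho> \<pi>opt s a > 0 \<longrightarrow> pmf d (s, a) > 0) \<longrightarrow>
       0 < \<delta> \<longrightarrow> \<delta> < 1 \<longrightarrow>
       real n > 8 * ln (2 * real (S * A) / \<delta>) / min_sampling_prob S A d \<longrightarrow>
       measure (sampling_space n d \<sigma>)
         {\<omega> \<in> space (sampling_space n d \<sigma>).
            \<forall>f. lcb_output S A (lcb_penalty c_b V q S A \<delta>) n (dataset h r \<omega>) f \<longrightarrow>
              SubOpt r \<rho> \<pi>opt (deterministic_policy f)
                \<le> c_0 * (\<Sum>(s, a)\<in>sampled_pairs S A d. visitation \<rho> \<pi>opt s a *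
                     mean_rating_inv R h \<sigma>
                       (sqrt (V\<^sup>2 * (ln (real (S * A) / \<delta>)) ^ q / (real n * pmf d (s, a)))))}
         \<ge> 1 - \<delta>"
proof (rule exI[of _ "4 * exp 200"], intro conjI allI)
  fix q :: nat and C1 C2 :: real
  \<comment> \<open>\<open>gap_factor\<close> written out, since it must be fixed before the
    instance; the summand 1 keeps it positive even for \<open>C1 = 0\<close>.\<close>
  define c0 where "c0 = 1 + real (nat \<lceil>2 * (4 * exp 200 + 10 * 2 ^ q + 4 * exp 200) :: real\<rceil>) * C1\<^sup>2"
  show "\<exists>c_0>0.
     \<forall>(S::nat) (A::nat) (R::real) (r :: nat \<Rightarrow> nat \<Rightarrow> real) (\<rho> :: nat pmf)
      (\<sigma>::real) (h :: real \<Rightarrow> real \<Rightarrow> real) (V::real) (d :: (nat \<times> nat) pmf)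
      (\<pi>opt :: nat \<Rightarrow> nat pmf) (\<delta>::real) (n::nat).
       contextual_bandit S A R r \<rho> \<longrightarrow>
       rating_model q R \<sigma> h C1 C2 \<longrightarrow>
       (\<forall>x\<in>{0..R}. rating_variance h \<sigma> x \<le> V\<^sup>2) \<longrightarrow>
       set_pmf d \<subseteq> {1..S} \<times> {1..A} \<longrightarrow>
       is_optimal_policy S A r \<pi>opt \<longrightarrow>
       (\<forall>s\<in>{1..S}. \<forall>a\<in>{1..A}. visitation \<rho> \<pi>opt s a > 0 \<longrightarrow> pmf d (s, a) > 0) \<longrightarrow>
       0 < \<delta> \<longrightarrow> \<delta> < 1 \<longrightarrow>
       real n > 8 * ln (2 * real (S * A) / \<delta>) / min_sampling_prob S A d \<longrightarrow>
       measure (sampling_space n d \<sigma>)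
         {\<omega> \<in> space (sampling_space n d \<sigma>).
            \<forall>f. lcb_output S A (lcb_penalty (4 * exp 200) V q S A \<delta>) n (dataset h r \<omega>) f \<longrightarrow>
              SubOpt r \<rho> \<pi>opt (deterministic_policy f)
                \<le> c_0 * (\<Sum>(s, a)\<in>sampled_pairs S A d. visitation \<rho> \<pi>opt s a *
                     mean_rating_inv R h \<sigma>
                       (sqrt (V\<^sup>2 * (ln (real (S * A) / \<delta>)) ^ q / (real n * pmf d (s, a)))))}
         \<ge> 1 - \<delta>"
  proof (intro exI[of _ c0] conjI allI impI)
    show "0 < c0" unfolding c0_def
      by (intro add_pos_nonneg mult_nonneg_nonneg zero_less_one of_nat_0_le_iff zero_le_power2)
    fix S A :: nat and R :: real and r :: "nat \<Rightarrow> nat \<Rightarrow> real" and \<rho> :: "nat pmf"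
      and \<sigma> :: real and h :: "real \<Rightarrow> real \<Rightarrow> real" and V :: real and d :: "(nat \<times> nat) pmf"
      and \<pi>opt :: "nat \<Rightarrow> nat pmf" and \<delta> :: real and n :: nat
    assume "contextual_bandit S A R r \<rho>" "rating_model q R \<sigma> h C1 C2"
      "\<forall>x\<in>{0..R}. rating_variance h \<sigma> x \<le> V\<^sup>2" "set_pmf d \<subseteq> {1..S} \<times> {1..A}"
      "is_optimal_policy S A r \<pi>opt"
      "\<forall>s\<in>{1..S}. \<forall>a\<in>{1..A}. visitation \<rho> \<pi>opt s a > 0 \<longrightarrow> pmf d (s, a) > 0"
      "0 < \<delta>" "\<delta> < 1" "real n > 8 * ln (2 * real (S * A) / \<delta>) / min_sampling_prob S A d"
    then interpret lcb_setting q C1 C2 S A R r \<rho> \<sigma> h V d \<pi>opt \<delta> n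
      by unfold_locales auto
    have "gap_factor \<le> c0" unfolding c0_def gap_factor_def noise_factor_def by linarith
    then have "{\<omega> \<in> space \<Omega>. success (4 * exp 200) gap_factor \<omega>}
        \<subseteq> {\<omega> \<in> space \<Omega>. success (4 * exp 200) c0 \<omega>}"
      using success_mono by blast
    then have "prob {\<omega> \<in> space \<Omega>. success (4 * exp 200) gap_factor \<omega>}
        \<le> prob {\<omega> \<in> space \<Omega>. success (4 * exp 200) c0 \<omega>}"
      by (rule finite_measure_mono[OF _ success_event])
    then have "1 - \<delta> \<le> prob {\<omega> \<in> space \<Omega>. success (4 * exp 200) c0 \<omega>}"
      using prob_success by linarith
    then show "1 - \<delta> \<le> measure (sampling_space n d \<sigma>)
         {\<omega> \<in> space (sampling_space n d \<sigma>).
            \<forall>f. lcb_output S A (lcb_penalty (4 * exp 200) V q S A \<delta>) n (dataset h r \<omega>) f \<longrightarrow>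
              SubOpt r \<rho> \<pi>opt (deterministic_policy f)
                \<le> c0 * (\<Sum>(s, a)\<in>sampled_pairs S A d. visitation \<rho> \<pi>opt s a *
                     mean_rating_inv R h \<sigma>
                       (sqrt (V\<^sup>2 * (ln (real (S * A) / \<delta>)) ^ q / (real n * pmf d (s, a)))))}"
      unfolding success_def radius_def L_def .
  qed
qed simp

end
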